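(* Let $T>0$, $I=]0,T[$, $m>0$, $q^0>0$, $u^0\in\mathbb{R}$, and let $f$ be integrable on $I$. For $h=T/N$, $N\ge 1$ an integer, let $q_h,u_h,\gamma_h,\lambda_h$ be the functions produced by the particle/plane algorithm with time step $h$ (defined in the context). When $h$ goes to zero (i.e. $N\to\infty$), there exist subsequences, still denoted by $(q_h)_h$, $(u_h)_h$, $(\lambda_h)_h$ and $(\gamma_h)_h$, and there exist $q\in W^{1,1}(I)\cap\mathcal{C}(I)$, $\gamma\in BV(I)$, $u\in L^1(I)$ and $\lambda\in\mathcal{M}(I)$ such that $$ \begin{array}{l} u_h\longrightarrow u \ \text{ in } L^1(I),\\ q_h\longrightarrow q \ \text{ in } W^{1,1}(I) \text{ and in } L^\infty(I), \text{ with } \dot q=u,\\ \lambda_h\rightharpoonup\lambda \ \text{ weakly-}\star \text{ in } \mathcal{M}(I),\\ \gamma_h\longrightarrow\gamma \ \text{ in } L^1(I), \text{ with } \dot\gamma=-\lambda \text{ in } \mathcal{M}(I), \end{array} $$ and $(q,\gamma)$ is a solution to the problem $$ \left\{ \begin{array}{l} \displaystyle m\dot q(t)+\gamma(t)=m\left(\dot q(0)+\int_0^t f(s)\,ds\right),\\ q\ge 0,\quad \gamma\le 0,\quad q\gamma=0,\\ q(0)=q^0>0,\quad \dot q(0)=u^0, \end{array} \right. $$ where the first equation and the relations $\gamma\le 0$, $q\gamma=0$ are understood almost everywhere on $I$.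
   Context: $\mathcal{M}(I)=(\mathcal{C}_c(I))'$ is the space of measures on $I$, and $BV(I)$ is the space of functions of bounded variation on $I$; for $\gamma\in BV(I)$, $\dot\gamma$ denotes its differential measure. Since $\gamma\in BV(I)$, the first equation of the limit problem makes $\dot q$ (a.e. equal to) a $BV$ function, and $\dot q(0)$ denotes its initial value (right limit at $0$). Particle/plane algorithm. Let $h=T/N$, $t^n=nh$, and $f^n=\frac1h\int_{t^n}^{t^{n+1}}f(s)\,ds$ for $0\le n\le N-1$. Initialize with $q^0>0$, $u^0\in\mathbb{R}$, $\gamma^0=\lambda^0=0$. Given $q^n,u^n,\gamma^n,\lambda^n$: (1) Set $u^{n+1/2}=u^n+hf^n$. (2) Let $\bar u^{n+1}$ be the projection of $u^{n+1/2}$ onto $K(q^n,\gamma^n)$, i.e. $\bar u^{n+1}\in K(q^n,\gamma^n)$ and $\frac12|\bar u^{n+1}-u^{n+1/2}|_m^2=\min_{v\in K(q^n,\gamma^n)}\frac12|v-u^{n+1/2}|_m^2$, where $|v|_m^2=m v^2$ and $K(q,\gamma)=\{v\in\mathbb{R}: q+hv\ge 0\}$ if $\gamma=0$, $K(q,\gamma)=\{v\in\mathbb{R}: q+hv=0\}$ if $\gamma<0$. The associated Lagrange multiplier $\lambda^{n+1}$ is defined by $m(\bar u^{n+1}-u^{n+1/2})=h\lambda^{n+1}$. (3) Set $\bar\gamma^{n+1}=\gamma^n-h\lambda^{n+1}$. (4) If $\bar\gamma^{n+1}\le 0$, set $u^{n+1}=\bar u^{n+1}$ and $\gamma^{n+1}=\bar\gamma^{n+1}$.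 If $\bar\gamma^{n+1}>0$, set $u^{n+1}=\bar\gamma^{n+1}/m$ and $\gamma^{n+1}=0$. (5) Set $q^{n+1}=q^n+hu^{n+1}$. Interpolated functions. $q_h$ and $\gamma_h$ are the continuous functions on $[0,T]$, affine on each $[t^n,t^{n+1}]$, with $q_h(t^n)=q^n$ and $\gamma_h(t^n)=\gamma^n$. $u_h=\dot q_h$ is piecewise constant, equal to $u^{n+1}$ on $]t^n,t^{n+1}[$. $\lambda_h=-\dot\gamma_h$ is piecewise constant, equal to $-(\gamma^{n+1}-\gamma^n)/h$ on $]t^n,t^{n+1}[$. *)

theory Defs
  imports "HOL-Analysis.Analysis" "HOL-Probability.Essential_Supremum"
begin

section \<open>Function spaces and modes of convergence on an interval\<close>

text \<open>
  Functions on an open interval \<open>I\<close> are rendered as functions \<open>real \<Rightarrow> real\<close> whose values outside \<open>I\<close>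
  are irrelevant. Classes of functions modulo a.e. equality are represented by their members.
\<close>

definition L1_conv :: "real set \<Rightarrow> (nat \<Rightarrow> real \<Rightarrow> real) \<Rightarrow> (real \<Rightarrow> real) \<Rightarrow> bool" where
  "L1_conv I X x \<longleftrightarrow>
     (\<forall>k. integrable (lebesgue_on I) (X k)) \<and> integrable (lebesgue_on I) x \<and>
     (\<lambda>k. LINT t|lebesgue_on I. \<bar>X k t - x t\<bar>) \<longlonglongrightarrow> 0"

definition Linfty_conv :: "real set \<Rightarrow> (nat \<Rightarrow> real \<Rightarrow> real) \<Rightarrow> (real \<Rightarrow> real) \<Rightarrow> bool" where
  "Linfty_conv I X x \<longleftrightarrow> (\<lambda>k. esssup (lebesgue_on I) (\<lambda>t. ereal \<bar>X k t - x t\<bar>)) \<longlonglongrightarrow> 0"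

text \<open>The space \<open>C\<^sub>c(I)\<close>, its elements being extended by zero outside \<open>I\<close>.\<close>

definition Cc :: "real set \<Rightarrow> (real \<Rightarrow> real) set" where
  "Cc I = {\<phi>. continuous_on UNIV \<phi> \<and>
             compact (closure {t. \<phi> t \<noteq> 0}) \<and> closure {t. \<phi> t \<noteq> 0} \<subseteq> I}"

definition Cc_smooth :: "real set \<Rightarrow> (real \<Rightarrow> real) set" where
  "Cc_smooth I = {\<phi> \<in> Cc I. \<forall>k t. (deriv ^^ k) \<phi> field_differentiable at t}"

definition has_weak_derivative :: "real set \<Rightarrow> (real \<Rightarrow> real) \<Rightarrow> (real \<Rightarrow> real) \<Rightarrow> bool" where
  "has_weak_derivative I g g' \<longleftrightarrow>
     integrable (lebesgue_on I) g \<and> integrable (lebesgue_on I) g' \<and>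
     (\<forall>\<phi>\<in>Cc_smooth I.
        (LINT t|lebesgue_on I. g t * deriv \<phi> t) = - (LINT t|lebesgue_on I. g' t * \<phi> t))"

definition W11 :: "real set \<Rightarrow> (real \<Rightarrow> real) set" where
  "W11 I = {g. \<exists>g'. has_weak_derivative I g g'}"

text \<open>Weak derivatives are unique almost everywhere, so their choice below is immaterial.\<close>

definition W11_conv :: "real set \<Rightarrow> (nat \<Rightarrow> real \<Rightarrow> real) \<Rightarrow> (real \<Rightarrow> real) \<Rightarrow> bool" where
  "W11_conv I X x \<longleftrightarrow>
     (\<exists>X' x'. (\<forall>k. has_weak_derivative I (X k) (X' k)) \<and> has_weak_derivative I x x' \<and>
        L1_conv I X x \<and> L1_conv I X' x')"

text \<open>
  The space of measures \<open>M(I) = (C\<^sub>c(I))'\<close>: the linear forms on \<open>C\<^sub>c(I)\<close> that are continuous for the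
  supremum norm. Only the values of the forms on \<open>C\<^sub>c(I)\<close> are relevant.
\<close>

definition measures_on :: "real set \<Rightarrow> ((real \<Rightarrow> real) \<Rightarrow> real) set" where
  "measures_on I = {\<mu>.
     (\<forall>\<phi>\<in>Cc I. \<forall>\<psi>\<in>Cc I. \<mu> (\<lambda>t. \<phi> t + \<psi> t) = \<mu> \<phi> + \<mu> \<psi>) \<and>
     (\<forall>c. \<forall>\<phi>\<in>Cc I. \<mu> (\<lambda>t. c * \<phi> t) = c * \<mu> \<phi>) \<and>
     (\<exists>C. \<forall>\<phi>\<in>Cc I. \<bar>\<mu> \<phi>\<bar> \<le> C * (SUP t. \<bar>\<phi> t\<bar>))}"

definition density_form :: "real set \<Rightarrow> (real \<Rightarrow> real) \<Rightarrow> (real \<Rightarrow> real) \<Rightarrow> real" where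
  "density_form I g \<phi> = (LINT t|lebesgue_on I. g t * \<phi> t)"

definition weak_star_conv ::
  "real set \<Rightarrow> (nat \<Rightarrow> (real \<Rightarrow> real) \<Rightarrow> real) \<Rightarrow> ((real \<Rightarrow> real) \<Rightarrow> real) \<Rightarrow> bool" where
  "weak_star_conv I M \<mu> \<longleftrightarrow>
     (\<forall>k. M k \<in> measures_on I) \<and> \<mu> \<in> measures_on I \<and> (\<forall>\<phi>\<in>Cc I. (\<lambda>k. M k \<phi>) \<longlonglongrightarrow> \<mu> \<phi>)"

definition BV :: "real set \<Rightarrow> (real \<Rightarrow> real) set" where
  "BV I = {g. \<exists>B. \<forall>n (s :: nat \<Rightarrow> real). s ` {..n} \<subseteq> I \<and> mono_on {..n} s \<longrightarrow>
                (\<Sum>i<n. \<bar>g (s (Suc i)) - g (s i)\<bar>) \<le> B}"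

text \<open>
  The differential measure of \<open>g\<close> is the element of \<open>M(I)\<close> that represents the derivative of \<open>g\<close> in
  the sense of distributions.
\<close>

definition has_differential_measure ::
  "real set \<Rightarrow> (real \<Rightarrow> real) \<Rightarrow> ((real \<Rightarrow> real) \<Rightarrow> real) \<Rightarrow> bool" where
  "has_differential_measure I g \<mu> \<longleftrightarrow>
     integrable (lebesgue_on I) g \<and> \<mu> \<in> measures_on I \<and>
     (\<forall>\<phi>\<in>Cc_smooth I. (LINT t|lebesgue_on I. g t * deriv \<phi> t) = - \<mu> \<phi>)"


section \<open>The particle/plane algorithm\<close>

text \<open>\<open>\<gamma> > 0\<close> never occurs in the algorithm, so the second branch is the case \<open>\<gamma> < 0\<close>.\<close>

definition admissible :: "real \<Rightarrow> real \<Rightarrow> real \<Rightarrow> real set" where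
  "admissible h q \<gamma> = (if \<gamma> = 0 then {v. q + h * v \<ge> 0} else {v. q + h * v = 0})"

text \<open>The states are the quadruples \<open>(q\<^sup>n, u\<^sup>n, \<gamma>\<^sup>n, \<lambda>\<^sup>n)\<close>; \<open>F\<close> is the average force \<open>f\<^sup>n\<close>.\<close>

type_synonym state = "real \<times> real \<times> real \<times> real"

definition algo_step :: "real \<Rightarrow> real \<Rightarrow> real \<Rightarrow> state \<Rightarrow> state" where
  "algo_step m h F = (\<lambda>(q, u, \<gamma>, l).
     let u_half = u + h * F;
         u_bar = arg_min (\<lambda>v. 1 / 2 * (m * (v - u_half)\<^sup>2)) (\<lambda>v. v \<in> admissible h q \<gamma>);
         l_new = m * (u_bar - u_half) / h;
         \<gamma>_bar = \<gamma> - h * l_new;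
         u_new = (if \<gamma>_bar \<le> 0 then u_bar else \<gamma>_bar / m);
         \<gamma>_new = (if \<gamma>_bar \<le> 0 then \<gamma>_bar else 0)
     in (q + h * u_new, u_new, \<gamma>_new, l_new))"

definition average_force :: "real \<Rightarrow> (real \<Rightarrow> real) \<Rightarrow> nat \<Rightarrow> real" where
  "average_force h f n = 1 / h * (LINT s|lebesgue_on {real n * h<..<real (Suc n) * h}. f s)"

text \<open>Only the states with index at most \<open>N\<close>, where \<open>h = T / N\<close>, are meaningful.\<close>

primrec algo :: "real \<Rightarrow> real \<Rightarrow> (real \<Rightarrow> real) \<Rightarrow> real \<Rightarrow> real \<Rightarrow> nat \<Rightarrow> state" where
  "algo m h f q0 u0 0 = (q0, u0, 0, 0)"
| "algo m h f q0 u0 (Suc n) = algo_step m h (average_force h f n) (algo m h f q0 u0 n)"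

definition algo_q :: "real \<Rightarrow> real \<Rightarrow> (real \<Rightarrow> real) \<Rightarrow> real \<Rightarrow> real \<Rightarrow> nat \<Rightarrow> real" where
  "algo_q m h f q0 u0 n = fst (algo m h f q0 u0 n)"

definition algo_u :: "real \<Rightarrow> real \<Rightarrow> (real \<Rightarrow> real) \<Rightarrow> real \<Rightarrow> real \<Rightarrow> nat \<Rightarrow> real" where
  "algo_u m h f q0 u0 n = fst (snd (algo m h f q0 u0 n))"

definition algo_gamma :: "real \<Rightarrow> real \<Rightarrow> (real \<Rightarrow> real) \<Rightarrow> real \<Rightarrow> real \<Rightarrow> nat \<Rightarrow> real" where
  "algo_gamma m h f q0 u0 n = fst (snd (snd (algo m h f q0 u0 n)))"

text \<open>
  For \<open>t \<ge> 0\<close>, \<open>cell h t\<close> is the index \<open>n\<close> with \<open>n h \<le> t < (n + 1) h\<close>. The piecewise constant functions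
  below are thereby also given values at the nodes, which form a null set.
\<close>

definition cell :: "real \<Rightarrow> real \<Rightarrow> nat" where
  "cell h t = nat \<lfloor>t / h\<rfloor>"

definition affine_interp :: "real \<Rightarrow> (nat \<Rightarrow> real) \<Rightarrow> real \<Rightarrow> real" where
  "affine_interp h a t =
     (let n = cell h t in a n + (t - real n * h) / h * (a (Suc n) - a n))"

definition q_interp :: "real \<Rightarrow> real \<Rightarrow> (real \<Rightarrow> real) \<Rightarrow> real \<Rightarrow> real \<Rightarrow> real \<Rightarrow> real" where
  "q_interp m h f q0 u0 = affine_interp h (algo_q m h f q0 u0)"

definition gamma_interp :: "real \<Rightarrow> real \<Rightarrow> (real \<Rightarrow> real) \<Rightarrow> real \<Rightarrow> real \<Rightarrow> real \<Rightarrow> real" where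
  "gamma_interp m h f q0 u0 = affine_interp h (algo_gamma m h f q0 u0)"

definition u_interp :: "real \<Rightarrow> real \<Rightarrow> (real \<Rightarrow> real) \<Rightarrow> real \<Rightarrow> real \<Rightarrow> real \<Rightarrow> real" where
  "u_interp m h f q0 u0 t = algo_u m h f q0 u0 (Suc (cell h t))"

definition lambda_interp :: "real \<Rightarrow> real \<Rightarrow> (real \<Rightarrow> real) \<Rightarrow> real \<Rightarrow> real \<Rightarrow> real \<Rightarrow> real" where
  "lambda_interp m h f q0 u0 t =
     (let n = cell h t in - (algo_gamma m h f q0 u0 (Suc n) - algo_gamma m h f q0 u0 n) / h)"


section \<open>The limit problem\<close>

text \<open>
  Since \<open>g\<close> is only determined almost everywhere, its initial value is the right limit at \<open>0\<close> of a
  representative of bounded variation.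
\<close>

definition has_initial_value :: "real \<Rightarrow> (real \<Rightarrow> real) \<Rightarrow> real \<Rightarrow> bool" where
  "has_initial_value T g a \<longleftrightarrow>
     (\<exists>v\<in>BV {0<..<T}. (AE t in lebesgue_on {0<..<T}. g t = v t) \<and> (v \<longlongrightarrow> a) (at_right 0))"

text \<open>
  Here \<open>dq\<close> and \<open>dq_init\<close> stand for the weak derivative of \<open>q\<close> and its initial value. As \<open>q\<close> is a
  function on the open interval, its value at \<open>0\<close> is that of its continuous extension.
\<close>

definition solves_limit_problem ::
  "real \<Rightarrow> real \<Rightarrow> (real \<Rightarrow> real) \<Rightarrow> real \<Rightarrow> real \<Rightarrow> (real \<Rightarrow> real) \<Rightarrow> (real \<Rightarrow> real) \<Rightarrow> bool" where
  "solves_limit_problem T m f q0 u0 q \<gamma> \<longleftrightarrow>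
     (\<exists>dq dq_init.
        has_weak_derivative {0<..<T} q dq \<and> has_initial_value T dq dq_init \<and>
        (AE t in lebesgue_on {0<..<T}.
           m * dq t + \<gamma> t = m * (dq_init + (LINT s|lebesgue_on {0<..<t}. f s))) \<and>
        (\<forall>t\<in>{0<..<T}. q t \<ge> 0) \<and>
        (AE t in lebesgue_on {0<..<T}. \<gamma> t \<le> 0) \<and>
        (AE t in lebesgue_on {0<..<T}. q t * \<gamma> t = 0) \<and>
        (q \<longlongrightarrow> q0) (at_right 0) \<and> q0 > 0 \<and> dq_init = u0)"

end

theory Submission
  imports Defs "HOL-Probability.Helly_Selection"
begin

text \<open>
  A step of the algorithm changes \<open>m u + \<gamma>\<close> by exactly \<open>m h f\<^sup>n\<close>: the projection moves momentum from \<open>u\<close>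
  to \<open>\<gamma>\<close>, and the correction that follows moves the excess back (\<open>algo_Suc\<close>). With
  \<open>g t = u\<^sup>0 + \<integral>\<^sub>0\<^sup>t f\<close> this reads \<open>m u\<^sup>n + \<gamma>\<^sup>n = m g(t\<^sup>n)\<close> at every node (\<open>conservation\<close>). Hence \<open>\<gamma>\<close> is
  the only quantity for which compactness is needed: it determines \<open>u\<close>, and \<open>q\<close> is obtained by
  integration.

  For \<open>\<gamma>\<close>, the point is a one-sided estimate. The algorithm preserves \<open>q \<ge> 0\<close>, \<open>\<gamma> \<le> 0\<close>, \<open>q \<gamma> = 0\<close>, and
  \<open>u \<le> 0\<close> whenever \<open>\<gamma> < 0\<close>. Therefore \<open>\<gamma>\<close> can jump down at an impact, but on its way up it gains at
  most what the force provides, \<open>m \<integral> |f|\<close> over the step. With \<open>V t = \<integral>\<^sub>0\<^sup>t |f|\<close>, the function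
  \<open>m V - \<gamma>\<^sub>h\<close>, with \<open>V\<close> interpolated at the nodes, is nondecreasing; it is bounded, because \<open>u \<le> 0\<close> in
  contact gives \<open>\<gamma>\<^sup>n \<ge> m g(t\<^sup>n)\<close>. Helly's selection theorem yields a subsequence that converges almost
  everywhere to a right-continuous monotone function \<open>F\<close> (\<open>Helly_subsequence\<close>), so \<open>\<gamma>\<^sub>h\<close> tends to
  \<open>\<gamma> = m V - F\<close>, a function of bounded variation. Dominated convergence gives the limit in \<open>L\<^sup>1\<close>. Up to an
  error \<open>h |\<lambda>\<^sub>h| / m\<close>, the velocity \<open>u\<^sub>h\<close> equals \<open>g - \<gamma>\<^sub>h / m\<close> with \<open>g\<close> taken at the next node, so \<open>u\<^sub>h\<close> tends
  to \<open>u = g - \<gamma> / m\<close> in \<open>L\<^sup>1\<close>, and then \<open>q\<^sub>h\<close> tends uniformly to the primitive \<open>q\<close> of \<open>u\<close>.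

  The same one-sided estimate bounds the total variation of \<open>\<gamma>\<^sup>n\<close>, that is, the \<open>L\<^sup>1\<close> norm of \<open>\<lambda>\<^sub>h\<close>.
  Integration by parts turns \<open>\<integral> \<lambda>\<^sub>h p\<close> into \<open>\<integral> \<gamma>\<^sub>h p'\<close> for continuously differentiable \<open>p\<close> vanishing at the
  ends of the interval. These integrals converge, and by the Weierstrass theorem such functions
  approximate those of \<open>C\<^sub>c(I)\<close> uniformly, so \<open>\<lambda>\<^sub>h\<close> converges in the weak-\<open>\<star>\<close> sense (\<open>weak_star_compactness\<close>).

  The relation \<open>q \<gamma> = 0\<close> holds at the nodes and fails between them by at most a multiple of \<open>h\<close>, so it
  passes to the limit almost everywhere. It also gives the initial velocity: \<open>q\<close> is positive near \<open>0\<close>,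
  hence the right limit of \<open>\<gamma>\<close> at \<open>0\<close> vanishes and that of \<open>u\<close> is \<open>g 0 = u\<^sup>0\<close>.
\<close>

section \<open>One step of the algorithm\<close>

lemma arg_min_eqI:
  fixes g :: "'a \<Rightarrow> real"
  assumes "P k" "\<And>x. P x \<Longrightarrow> x \<noteq> k \<Longrightarrow> g k < g x"
  shows "arg_min g P = k"
proof (rule arg_minI[where Q = "\<lambda>x. x = k" and x = k])
  show "P k" by fact
  show "\<not> g y < g k" if "P y" for y
    using assms(2)[OF that] by (cases "y = k") auto
  show "x = k" if "P x" "\<forall>y. P y \<longrightarrow> \<not> g y < g x" for x
    using that assms by blast
qed

lemma projection_admissible:
  assumes "m > 0" "h > 0"
  shows "arg_min (\<lambda>v. 1 / 2 * (m * (v - w)\<^sup>2)) (\<lambda>v. v \<in> admissible h q \<gamma>)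
    = (if \<gamma> = 0 then max w (- q / h) else - q / h)"
proof (cases "\<gamma> = 0")
  case True
  have "arg_min (\<lambda>v. 1 / 2 * (m * (v - w)\<^sup>2)) (\<lambda>v. v \<in> admissible h q \<gamma>) = max w (- q / h)"
  proof (rule arg_min_eqI)
    show "max w (- q / h) \<in> admissible h q \<gamma>"
      using assms True by (auto simp: admissible_def max_def field_simps)
    show "1 / 2 * (m * (max w (- q / h) - w)\<^sup>2) < 1 / 2 * (m * (x - w)\<^sup>2)"
      if "x \<in> admissible h q \<gamma>" "x \<noteq> max w (- q / h)" for x
    proof -
      have "- q / h \<le> x"
        using that(1) True assms by (auto simp: admissible_def field_simps)
      then have "\<bar>max w (- q / h) - w\<bar> < \<bar>x - w\<bar>"
        using that(2) by (auto simp: max_def abs_if split: if_splits)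
      then have "(max w (- q / h) - w)\<^sup>2 < (x - w)\<^sup>2"
        by (metis abs_ge_zero power2_abs power_strict_mono zero_less_numeral)
      then show ?thesis
        using assms by simp
    qed
  qed
  then show ?thesis
    using True by simp
next
  case False
  then have "(v \<in> admissible h q \<gamma>) = (v = - q / h)" for v
    using assms by (auto simp: admissible_def field_simps)
  then show ?thesis
    using False by (auto intro!: arg_min_eqI)
qed

text \<open>
  The last conjunct, on the velocity, is what keeps \<open>\<gamma>\<close> from rising faster than the force allows.
\<close>

definition contact_state :: "real \<Rightarrow> real \<Rightarrow> real \<Rightarrow> bool" where
  "contact_state q u \<gamma> \<longleftrightarrow> q \<ge> 0 \<and> \<gamma> \<le> 0 \<and> q * \<gamma> = 0 \<and> (\<gamma> < 0 \<longrightarrow> u \<le> 0)"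

text \<open>
  There are three cases. In free flight nothing is corrected. At an impact the projection lifts the
  velocity to \<open>- q / h \<le> 0\<close>, so that the particle lands on the plane, and \<open>\<gamma>\<close> takes up the lost momentum. In
  contact the projected velocity is \<open>0\<close> and \<open>\<gamma>\<close> receives all of \<open>m (u + h F)\<close>, where \<open>u \<le> 0\<close>; a
  positive result becomes the velocity of release. Only the last case lets \<open>\<gamma>\<close> increase.
\<close>

lemma algo_step_contact_state:
  assumes "m > 0" "h > 0" "contact_state q u \<gamma>"
    and step: "algo_step m h F (q, u, \<gamma>, l) = (q', u', \<gamma>', l')"
  shows "contact_state q' u' \<gamma>'" "q' = q + h * u'" "m * u' + \<gamma>' = m * u + \<gamma> + m * (h * F)"
    "\<gamma>' - \<gamma> \<le> m * \<bar>h * F\<bar>"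
proof -
  define w where "w = u + h * F"
  define v where "v = (if \<gamma> = 0 then max w (- q / h) else - q / h)"
  define g where "g = \<gamma> - m * (v - w)"
  have inv: "q \<ge> 0" "\<gamma> \<le> 0" "q * \<gamma> = 0" "\<gamma> < 0 \<Longrightarrow> u \<le> 0"
    using assms(3) by (auto simp: contact_state_def)
  have q': "q' = q + h * u'" and u': "u' = (if g \<le> 0 then v else g / m)"
    and \<gamma>': "\<gamma>' = (if g \<le> 0 then g else 0)"
    using step[unfolded algo_step_def prod.case Let_def projection_admissible[OF assms(1,2)]]
    unfolding g_def v_def w_def using assms(1,2) by auto
  have le: "m * (h * F) \<le> m * \<bar>h * F\<bar>"
    using \<open>m > 0\<close> by (intro mult_left_mono) auto
  have le0: "0 \<le> m * \<bar>h * F\<bar>"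
    using \<open>m > 0\<close> by simp
  show "q' = q + h * u'" by fact
  (* Free flight, impact, and contact carried over from the previous step. *)
  consider (free) "\<gamma> = 0" "- q / h \<le> w" | (hit) "\<gamma> = 0" "w < - q / h" | (touch) "\<gamma> < 0" "q = 0"
    using inv by fastforce
  then have "contact_state q' u' \<gamma>' \<and> m * u' + \<gamma>' = m * u + \<gamma> + m * (h * F)
      \<and> \<gamma>' - \<gamma> \<le> m * \<bar>h * F\<bar>"
  proof cases
    case free
    then have "u' = w" "\<gamma>' = 0"
      unfolding u' \<gamma>' g_def v_def by auto
    moreover from this free \<open>h > 0\<close> have "q' \<ge> 0"
      unfolding q' by (simp add: field_simps)
    ultimately show ?thesis
      using free le0 by (simp add: contact_state_def w_def algebra_simps)
  next
    case hit
    have g: "g = - (m * (- q / h - w))"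
      unfolding g_def v_def using hit by simp
    moreover have "m * (- q / h - w) > 0"
      using hit \<open>m > 0\<close> by simp
    ultimately have "g < 0" by simp
    then have new: "u' = - q / h" "\<gamma>' = - (m * (- q / h - w))"
      unfolding u' \<gamma>' using g hit by (auto simp: v_def)
    moreover have "q' = 0"
      unfolding q' new(1) using \<open>h > 0\<close> by simp
    moreover have "- q / h \<le> 0"
      using inv \<open>h > 0\<close> by simp
    ultimately show ?thesis
      using new hit \<open>m * (- q / h - w) > 0\<close> le0
      by (simp add: contact_state_def w_def algebra_simps)
  next
    case touch
    then have v: "v = 0" and g: "g = \<gamma> + m * u + m * (h * F)"
      by (auto simp: g_def v_def w_def algebra_simps)
    have "m * u \<le> 0"
      using touch inv \<open>m > 0\<close> by (simp add: mult_nonneg_nonpos)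
    then have "g - \<gamma> \<le> m * \<bar>h * F\<bar>"
      using g le by linarith
    then have "\<gamma>' - \<gamma> \<le> m * \<bar>h * F\<bar>"
      unfolding \<gamma>' by (cases "g \<le> 0") auto
    then show ?thesis
      using v g touch \<open>m > 0\<close> \<open>h > 0\<close>
      by (cases "g \<le> 0") (auto simp: contact_state_def q' u' \<gamma>')
  qed
  then show "contact_state q' u' \<gamma>'" "m * u' + \<gamma>' = m * u + \<gamma> + m * (h * F)"
    "\<gamma>' - \<gamma> \<le> m * \<bar>h * F\<bar>"
    by auto
qed

lemma algo_decompose:
  "algo m h f q0 u0 n = (algo_q m h f q0 u0 n, algo_u m h f q0 u0 n, algo_gamma m h f q0 u0 n,
     snd (snd (snd (algo m h f q0 u0 n))))"
  by (simp add: algo_q_def algo_u_def algo_gamma_def)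

lemma algo_contact_state:
  assumes "m > 0" "h > 0" "q0 \<ge> 0"
  shows "contact_state (algo_q m h f q0 u0 n) (algo_u m h f q0 u0 n) (algo_gamma m h f q0 u0 n)"
proof (induction n)
  case 0
  then show ?case
    using assms by (simp add: contact_state_def algo_q_def algo_u_def algo_gamma_def)
next
  case (Suc n)
  show ?case
    using algo_step_contact_state(1)[OF assms(1,2) Suc, of "average_force h f n"]
    by (metis algo.simps(2) algo_decompose)
qed

lemma algo_Suc:
  assumes "m > 0" "h > 0" "q0 \<ge> 0"
  shows "algo_q m h f q0 u0 (Suc n) = algo_q m h f q0 u0 n + h * algo_u m h f q0 u0 (Suc n)"
    "m * algo_u m h f q0 u0 (Suc n) + algo_gamma m h f q0 u0 (Suc n) =
      m * algo_u m h f q0 u0 n + algo_gamma m h f q0 u0 n + m * (h * average_force h f n)"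
    "algo_gamma m h f q0 u0 (Suc n) - algo_gamma m h f q0 u0 n \<le> m * \<bar>h * average_force h f n\<bar>"
  using algo_step_contact_state(2-4)[OF assms(1,2) algo_contact_state[OF assms],
      of "average_force h f n" f u0 n]
  by (metis algo.simps(2) algo_decompose)+

section \<open>Piecewise constant and piecewise affine functions\<close>

lemma cell_eq:
  assumes "h > 0" "real n * h \<le> t" "t < real (Suc n) * h"
  shows "cell h t = n"
proof -
  have "\<lfloor>t / h\<rfloor> = int n"
    using assms by (intro floor_unique) (auto simp: field_simps)
  then show ?thesis
    by (simp add: cell_def)
qed

lemma cell_bounds:
  assumes "h > 0" "t \<ge> 0"
  shows "real (cell h t) * h \<le> t" "t < real (Suc (cell h t)) * h"
proof -
  have "real (cell h t) = of_int \<lfloor>t / h\<rfloor>"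
    using assms by (simp add: cell_def)
  then show "real (cell h t) * h \<le> t" "t < real (Suc (cell h t)) * h"
    using assms floor_correct[of "t / h"]
      pos_le_divide_eq[of h "of_int \<lfloor>t / h\<rfloor>" t] pos_divide_less_eq[of h t]
    by (auto simp: add.commute)
qed

text \<open>
  Over the time interval of the algorithm only the states up to \<open>N\<close> are used; the later ones depend
  on values of the force outside that interval.
\<close>

lemma cell_less:
  assumes "h > 0" "t \<ge> 0" "t < real N * h"
  shows "cell h t < N"
proof -
  have "real (cell h t) * h < real N * h"
    using cell_bounds(1)[OF assms(1,2)] assms(3) by linarith
  then show ?thesis
    using assms(1) by simp
qed

text \<open>
  At the right end of a cell the definition of the interpolant has already passed to the next cell;
  both formulas give the value at the common node.
\<close>

lemma affine_interp_eq:
  assumes "h > 0" "real n * h \<le> t" "t \<le> real (Suc n) * h"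
  shows "affine_interp h a t = a n + (t - real n * h) / h * (a (Suc n) - a n)"
proof (cases "t < real (Suc n) * h")
  case True
  then show ?thesis
    using cell_eq[OF assms(1,2)] by (simp add: affine_interp_def Let_def)
next
  case False
  then have "t = real (Suc n) * h"
    using assms by simp
  moreover from this have "cell h t = Suc n"
    using assms(1) by (intro cell_eq) (auto simp: field_simps)
  ultimately show ?thesis
    using assms(1) by (simp add: affine_interp_def Let_def field_simps)
qed

lemma affine_interp_node: "h > 0 \<Longrightarrow> affine_interp h a (real n * h) = a n"
  by (subst affine_interp_eq[of h n]) (auto simp: field_simps)

text \<open>
  The weight does not depend on the interpolated sequence. Most estimates on interpolants reduce to
  this form.
\<close>

lemma affine_interp_convex:
  assumes "h > 0" "t \<ge> 0"
  obtains s where "0 \<le> s" "s \<le> 1"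
    "\<And>a. affine_interp h a t = (1 - s) * a (cell h t) + s * a (Suc (cell h t))"
proof
  let ?s = "(t - real (cell h t) * h) / h"
  show "0 \<le> ?s" "?s \<le> 1"
    using cell_bounds[OF assms] assms by (auto simp: field_simps)
  show "affine_interp h a t = (1 - ?s) * a (cell h t) + ?s * a (Suc (cell h t))" for a
    unfolding affine_interp_def Let_def by algebra
qed

lemma affine_interp_diff:
  "affine_interp h (\<lambda>n. c * a n - d * b n) t = c * affine_interp h a t - d * affine_interp h b t"
  unfolding affine_interp_def Let_def by algebra

lemma continuous_on_affine_interp:
  assumes "h > 0"
  shows "continuous_on {0..real N * h} (affine_interp h a)"
proof (induction N)
  case 0
  then show ?case by simp
next
  case (Suc N)
  have "continuous_on {real N * h..real (Suc N) * h} (affine_interp h a) \<longleftrightarrow>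
      continuous_on {real N * h..real (Suc N) * h} (\<lambda>t. a N + (t - real N * h) / h * (a (Suc N) - a N))"
    using assms by (intro continuous_on_cong) (auto simp: affine_interp_eq)
  then have "continuous_on {real N * h..real (Suc N) * h} (affine_interp h a)"
    using assms by (auto intro!: continuous_intros)
  with Suc have "continuous_on ({0..real N * h} \<union> {real N * h..real (Suc N) * h}) (affine_interp h a)"
    by (intro continuous_on_closed_Un) auto
  moreover have "{0..real N * h} \<union> {real N * h..real (Suc N) * h} = {0..real (Suc N) * h}"
    using assms by (intro ivl_disj_un_two_touch(4)) (auto simp: field_simps)
  ultimately show ?case by simp
qed

lemma abs_convex_combination_le:
  fixes s x y :: real
  assumes "0 \<le> s" "s \<le> 1" "\<bar>x\<bar> \<le> a" "\<bar>y\<bar> \<le> b"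
  shows "\<bar>(1 - s) * x + s * y\<bar> \<le> (1 - s) * a + s * b"
proof -
  have "\<bar>(1 - s) * x\<bar> \<le> (1 - s) * a" "\<bar>s * y\<bar> \<le> s * b"
    using assms by (auto simp: abs_mult intro: mult_left_mono)
  then show ?thesis
    by linarith
qed

lemma affine_interp_mono:
  assumes "h > 0" "incseq a" "0 \<le> s" "s \<le> t"
  shows "affine_interp h a s \<le> affine_interp h a t"
proof -
  let ?i = "cell h s" and ?j = "cell h t"
  have le: "(x - real (cell h x) * h) / h * (a (Suc (cell h x)) - a (cell h x)) \<ge> 0"
      "(x - real (cell h x) * h) / h * (a (Suc (cell h x)) - a (cell h x)) \<le> a (Suc (cell h x)) - a (cell h x)"
    if "x \<ge> 0" for x
  proof -
    have "0 \<le> (x - real (cell h x) * h) / h" "(x - real (cell h x) * h) / h \<le> 1"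
      using cell_bounds[OF assms(1) that] assms(1) by (auto simp: field_simps)
    moreover have "0 \<le> a (Suc (cell h x)) - a (cell h x)"
      using incseqD[OF assms(2), of "cell h x" "Suc (cell h x)"] by simp
    ultimately show "(x - real (cell h x) * h) / h * (a (Suc (cell h x)) - a (cell h x)) \<ge> 0"
      "(x - real (cell h x) * h) / h * (a (Suc (cell h x)) - a (cell h x)) \<le> a (Suc (cell h x)) - a (cell h x)"
      using mult_nonneg_nonneg mult_left_le_one_le by blast+
  qed
  have "s / h \<le> t / h"
    using assms by (simp add: divide_right_mono)
  then have "?i \<le> ?j"
    unfolding cell_def by (intro nat_mono floor_mono)
  then consider "?i = ?j" | "Suc ?i \<le> ?j"
    by linarith
  then show ?thesis
  proof cases
    case 1
    have "(s - real ?i * h) / h * (a (Suc ?i) - a ?i) \<le> (t - real ?i * h) / h * (a (Suc ?i) - a ?i)"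
      using assms incseqD[OF assms(2), of ?i "Suc ?i"] by (intro mult_right_mono divide_right_mono) auto
    then show ?thesis
      using 1 by (simp add: affine_interp_def Let_def)
  next
    case 2
    have "affine_interp h a s \<le> a (Suc ?i)"
      using le(2)[of s] assms by (simp add: affine_interp_def Let_def)
    also have "\<dots> \<le> a ?j"
      using assms(2) 2 by (rule incseqD)
    also have "\<dots> \<le> affine_interp h a t"
      using le(1)[of t] assms by (simp add: affine_interp_def Let_def)
    finally show ?thesis .
  qed
qed

lemma affine_interp_bound:
  assumes "h > 0" "t \<ge> 0" "\<bar>a (cell h t)\<bar> \<le> B" "\<bar>a (Suc (cell h t))\<bar> \<le> B"
  shows "\<bar>affine_interp h a t\<bar> \<le> B"
proof -
  obtain s where s: "0 \<le> s" "s \<le> 1" "affine_interp h a t = (1 - s) * a (cell h t) + s * a (Suc (cell h t))"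
    using affine_interp_convex[OF assms(1,2)] by metis
  have "\<bar>affine_interp h a t\<bar> \<le> (1 - s) * B + s * B"
    unfolding s(3) using s(1,2) assms(3,4) by (rule abs_convex_combination_le)
  then show ?thesis
    by (simp add: left_diff_distrib)
qed

lemma tendsto_node:
  fixes h :: "nat \<Rightarrow> real"
  assumes "\<And>k. h k > 0" "h \<longlonglongrightarrow> 0" "t \<ge> 0"
  shows "(\<lambda>k. real (cell (h k) t) * h k) \<longlonglongrightarrow> t" "(\<lambda>k. real (Suc (cell (h k) t)) * h k) \<longlonglongrightarrow> t"
proof -
  show node: "(\<lambda>k. real (cell (h k) t) * h k) \<longlonglongrightarrow> t"
  proof (rule tendsto_sandwich)
    have "t - h k \<le> real (cell (h k) t) * h k" for k
      using cell_bounds(2)[OF assms(1,3), of k] by (simp add: distrib_right)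
    then show "\<forall>\<^sub>F k in sequentially. t - h k \<le> real (cell (h k) t) * h k"
      by simp
    show "\<forall>\<^sub>F k in sequentially. real (cell (h k) t) * h k \<le> t"
      using cell_bounds(1)[OF assms(1,3)] by simp
    show "(\<lambda>k. t - h k) \<longlonglongrightarrow> t"
      using tendsto_diff[OF tendsto_const assms(2), of t] by simp
  qed auto
  show "(\<lambda>k. real (Suc (cell (h k) t)) * h k) \<longlonglongrightarrow> t"
    using tendsto_add[OF node assms(2)] by (simp add: algebra_simps)
qed

lemma tendsto_affine_interp:
  fixes h :: "nat \<Rightarrow> real" and \<phi> :: "real \<Rightarrow> real"
  assumes "\<And>k. h k > 0" "h \<longlonglongrightarrow> 0" "0 \<le> t" "t \<in> S" "continuous_on S \<phi>"
    and nodes: "\<And>k. real (cell (h k) t) * h k \<in> S" "\<And>k. real (Suc (cell (h k) t)) * h k \<in> S"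
  shows "(\<lambda>k. affine_interp (h k) (\<lambda>n. \<phi> (real n * h k)) t) \<longlonglongrightarrow> \<phi> t"
proof -
  let ?x = "\<lambda>k. \<phi> (real (cell (h k) t) * h k)" and ?y = "\<lambda>k. \<phi> (real (Suc (cell (h k) t)) * h k)"
  have x: "?x \<longlonglongrightarrow> \<phi> t" and y: "?y \<longlonglongrightarrow> \<phi> t"
    using tendsto_node[OF assms(1-3)] nodes assms(4)
    by (auto intro!: continuous_on_tendsto_compose[OF assms(5)] always_eventually simp del: of_nat_Suc)
  show ?thesis
  proof (rule LIM_zero_cancel, rule tendsto_rabs_zero_cancel, rule tendsto_sandwich[OF _ _ tendsto_const])
    have "\<bar>affine_interp (h k) (\<lambda>n. \<phi> (real n * h k)) t - \<phi> t\<bar> \<le> \<bar>?x k - \<phi> t\<bar> + \<bar>?y k - \<phi> t\<bar>" for k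
    proof -
      obtain s where s: "0 \<le> s" "s \<le> 1" "affine_interp (h k) (\<lambda>n. \<phi> (real n * h k)) t = (1 - s) * ?x k + s * ?y k"
        using affine_interp_convex[OF assms(1,3)] by metis
      then have "affine_interp (h k) (\<lambda>n. \<phi> (real n * h k)) t - \<phi> t = (1 - s) * (?x k - \<phi> t) + s * (?y k - \<phi> t)"
        by (simp add: algebra_simps)
      also have "\<bar>\<dots>\<bar> \<le> (1 - s) * \<bar>?x k - \<phi> t\<bar> + s * \<bar>?y k - \<phi> t\<bar>"
        using s(1,2) by (rule abs_convex_combination_le) simp_all
      also have "\<dots> \<le> \<bar>?x k - \<phi> t\<bar> + \<bar>?y k - \<phi> t\<bar>"
        using s(1,2) by (intro add_mono mult_left_le_one_le) auto
      finally show ?thesis .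
    qed
    then show "\<forall>\<^sub>F k in sequentially. \<bar>affine_interp (h k) (\<lambda>n. \<phi> (real n * h k)) t - \<phi> t\<bar> \<le> \<bar>?x k - \<phi> t\<bar> + \<bar>?y k - \<phi> t\<bar>"
      by simp
    show "(\<lambda>k. \<bar>?x k - \<phi> t\<bar> + \<bar>?y k - \<phi> t\<bar>) \<longlonglongrightarrow> 0"
      using tendsto_add[OF tendsto_rabs_zero[OF LIM_zero[OF x]] tendsto_rabs_zero[OF LIM_zero[OF y]]] by simp
  qed auto
qed

section \<open>Convergence in \<open>L\<^sup>1\<close> and weak derivatives\<close>

lemma continuous_imp_integrable_Ioo:
  fixes \<phi> :: "real \<Rightarrow> real"
  assumes "continuous_on {a..b} \<phi>"
  shows "integrable (lebesgue_on {a<..<b}) \<phi>"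
proof -
  have "set_integrable lebesgue {a..b} \<phi>"
    using continuous_imp_integrable_real[OF assms] by (simp add: set_integrable_def integrable_restrict_space)
  then have "set_integrable lebesgue {a<..<b} \<phi>"
    by (rule set_integrable_subset) auto
  then show ?thesis
    by (simp add: set_integrable_def integrable_restrict_space)
qed

lemma continuous_imp_measurable_lebesgue_on:
  fixes \<phi> :: "real \<Rightarrow> real"
  assumes "continuous_on UNIV \<phi>"
  shows "\<phi> \<in> borel_measurable (lebesgue_on I)"
  using borel_measurable_continuous_onI[OF assms]
  by (intro measurable_restrict_space1 measurable_completion) simp

lemma continuous_bounded_on_interval:
  fixes \<phi> :: "real \<Rightarrow> real"
  assumes "continuous_on UNIV \<phi>"
  obtains B where "\<And>t. t \<in> {a<..<b} \<Longrightarrow> \<bar>\<phi> t\<bar> \<le> B"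
proof -
  have "compact (\<phi> ` {a..b})"
    using assms by (intro compact_continuous_image) (auto intro: continuous_on_subset)
  then obtain B where "\<forall>y \<in> \<phi> ` {a..b}. norm y \<le> B"
    using compact_imp_bounded[of "\<phi> ` {a..b}"] unfolding bounded_iff by blast
  then have "\<bar>\<phi> t\<bar> \<le> B" if "t \<in> {a..b}" for t
    using that by auto
  then show ?thesis
    by (intro that[of B]) auto
qed

lemma integrable_mult_bounded:
  fixes g \<psi> :: "'a \<Rightarrow> real"
  assumes "integrable M g" "\<psi> \<in> borel_measurable M" "\<And>t. t \<in> space M \<Longrightarrow> \<bar>\<psi> t\<bar> \<le> B"
  shows "integrable M (\<lambda>t. g t * \<psi> t)" "\<bar>LINT t|M. g t * \<psi> t\<bar> \<le> B * (LINT t|M. \<bar>g t\<bar>)"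
proof -
  have le: "\<bar>g t * \<psi> t\<bar> \<le> B * \<bar>g t\<bar>" if "t \<in> space M" for t
    using assms(3)[OF that] by (simp add: abs_mult mult.commute mult_right_mono)
  show int: "integrable M (\<lambda>t. g t * \<psi> t)"
  proof (rule Bochner_Integration.integrable_bound)
    show "integrable M (\<lambda>t. B * \<bar>g t\<bar>)"
      using assms(1) by simp
    show "AE t in M. norm (g t * \<psi> t) \<le> norm (B * \<bar>g t\<bar>)"
      using le by (force intro!: AE_I2)
    show "(\<lambda>t. g t * \<psi> t) \<in> borel_measurable M"
      using assms(1,2) by measurable
  qed
  have "\<bar>LINT t|M. g t * \<psi> t\<bar> \<le> (LINT t|M. \<bar>g t * \<psi> t\<bar>)"
    by simp
  also have "\<dots> \<le> (LINT t|M. B * \<bar>g t\<bar>)"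
    using int assms(1) le by (intro integral_mono) auto
  finally show "\<bar>LINT t|M. g t * \<psi> t\<bar> \<le> B * (LINT t|M. \<bar>g t\<bar>)"
    by simp
qed

lemma L1_conv_boundI:
  assumes "\<And>k. integrable (lebesgue_on I) (X k)" "integrable (lebesgue_on I) x"
    and "\<And>k. (LINT t|lebesgue_on I. \<bar>X k t - x t\<bar>) \<le> e k" "e \<longlonglongrightarrow> 0"
  shows "L1_conv I X x"
proof -
  have "(\<lambda>k. LINT t|lebesgue_on I. \<bar>X k t - x t\<bar>) \<longlonglongrightarrow> 0"
    by (rule tendsto_sandwich[OF _ _ tendsto_const assms(4)]) (use assms(3) in auto)
  then show ?thesis
    using assms by (simp add: L1_conv_def)
qed

lemma L1_conv_dominatedI:
  assumes I: "I \<in> lmeasurable"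
    and int: "\<And>k. integrable (lebesgue_on I) (X k)" "integrable (lebesgue_on I) x"
    and bound: "\<And>k t. t \<in> I \<Longrightarrow> \<bar>X k t\<bar> \<le> B"
    and lim: "AE t in lebesgue_on I. (\<lambda>k. X k t) \<longlonglongrightarrow> x t"
  shows "L1_conv I X x"
proof -
  interpret finite_measure "lebesgue_on I"
    using I by (rule finite_measure_lebesgue_on)
  have "(\<lambda>k. LINT t|lebesgue_on I. \<bar>X k t - x t\<bar>) \<longlonglongrightarrow> (LINT t|lebesgue_on I. 0)"
  proof (rule integral_dominated_convergence[where w = "\<lambda>t. B + \<bar>x t\<bar>"])
    show "integrable (lebesgue_on I) (\<lambda>t. B + \<bar>x t\<bar>)"
      using int by simp
    show "AE t in lebesgue_on I. (\<lambda>k. \<bar>X k t - x t\<bar>) \<longlonglongrightarrow> 0"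
      using lim by eventually_elim (simp add: LIM_zero tendsto_rabs_zero)
    show "AE t in lebesgue_on I. norm \<bar>X k t - x t\<bar> \<le> B + \<bar>x t\<bar>" for k
    proof (rule AE_I2)
      fix t assume "t \<in> space (lebesgue_on I)"
      then have "\<bar>X k t\<bar> \<le> B" using bound by simp
      then show "norm \<bar>X k t - x t\<bar> \<le> B + \<bar>x t\<bar>"
        using abs_triangle_ineq4[of "X k t" "x t"] by simp
    qed
    show "(\<lambda>t. \<bar>X k t - x t\<bar>) \<in> borel_measurable (lebesgue_on I)" for k
      using borel_measurable_integrable[OF int(1)] borel_measurable_integrable[OF int(2)]
      by measurable
  qed simp
  then show ?thesis
    using int by (simp add: L1_conv_def)
qed

lemma L1_conv_integral_mult:
  assumes "L1_conv I X x" "\<psi> \<in> borel_measurable (lebesgue_on I)" "\<And>t. t \<in> I \<Longrightarrow> \<bar>\<psi> t\<bar> \<le> B"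
  shows "(\<lambda>k. LINT t|lebesgue_on I. X k t * \<psi> t) \<longlonglongrightarrow> (LINT t|lebesgue_on I. x t * \<psi> t)"
proof (rule LIM_zero_cancel, rule tendsto_rabs_zero_cancel, rule tendsto_sandwich[OF _ _ tendsto_const])
  have int: "integrable (lebesgue_on I) (X k)" "integrable (lebesgue_on I) x" for k
    using assms(1) by (auto simp: L1_conv_def)
  have "(LINT t|lebesgue_on I. X k t * \<psi> t) - (LINT t|lebesgue_on I. x t * \<psi> t)
      = (LINT t|lebesgue_on I. (X k t - x t) * \<psi> t)" for k
    using integrable_mult_bounded(1)[OF int(1) assms(2), of B k] integrable_mult_bounded(1)[OF int(2) assms(2), of B]
      assms(3) by (simp add: left_diff_distrib)
  then show "\<forall>\<^sub>F k in sequentially. \<bar>(LINT t|lebesgue_on I. X k t * \<psi> t) - (LINT t|lebesgue_on I. x t * \<psi> t)\<bar>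
      \<le> B * (LINT t|lebesgue_on I. \<bar>X k t - x t\<bar>)"
    using integrable_mult_bounded(2)[OF _ assms(2), of "\<lambda>t. X k t - x t" B for k] int assms(3)
    by (intro always_eventually allI) auto
  show "(\<lambda>k. B * (LINT t|lebesgue_on I. \<bar>X k t - x t\<bar>)) \<longlonglongrightarrow> 0"
    using assms(1) by (auto simp: L1_conv_def intro: tendsto_mult_right_zero)
qed auto

text \<open>
  On a null set the essential supremum would be \<open>-\<infinity>\<close>, hence the hypothesis on the measure of \<open>I\<close>.
\<close>

lemma uniform_bound_imp_Linfty_conv:
  assumes I: "emeasure lebesgue I \<noteq> 0" "I \<in> sets lebesgue"
    and meas: "\<And>k. X k \<in> borel_measurable (lebesgue_on I)" "x \<in> borel_measurable (lebesgue_on I)"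
    and bound: "\<And>k t. t \<in> I \<Longrightarrow> \<bar>X k t - x t\<bar> \<le> e k" "e \<longlonglongrightarrow> 0"
  shows "Linfty_conv I X x"
  unfolding Linfty_conv_def
proof (rule tendsto_sandwich)
  have [measurable]: "(\<lambda>t. ereal \<bar>X k t - x t\<bar>) \<in> borel_measurable (lebesgue_on I)" for k
    using meas(1)[of k] meas(2) by measurable
  have "emeasure (lebesgue_on I) (space (lebesgue_on I)) \<noteq> 0"
    using I by (simp add: emeasure_restrict_space)
  then have "esssup (lebesgue_on I) (\<lambda>t. 0 :: ereal) = 0"
    by (rule esssup_const)
  then have "0 \<le> esssup (lebesgue_on I) (\<lambda>t. ereal \<bar>X k t - x t\<bar>)" for k
    using esssup_mono[of "\<lambda>t. 0 :: ereal" "lebesgue_on I" "\<lambda>t. ereal \<bar>X k t - x t\<bar>"] by simp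
  then show "\<forall>\<^sub>F k in sequentially. 0 \<le> esssup (lebesgue_on I) (\<lambda>t. ereal \<bar>X k t - x t\<bar>)"
    by simp
  show "\<forall>\<^sub>F k in sequentially. esssup (lebesgue_on I) (\<lambda>t. ereal \<bar>X k t - x t\<bar>) \<le> ereal (e k)"
    using bound(1) by (intro always_eventually allI esssup_I AE_I2) auto
  show "(\<lambda>k. ereal (e k)) \<longlonglongrightarrow> 0"
    using bound(2) by (simp add: zero_ereal_def)
qed auto

lemma Cc_bounded:
  assumes "\<phi> \<in> Cc I"
  obtains B where "\<And>t. \<bar>\<phi> t\<bar> \<le> B"
proof -
  let ?K = "closure {t. \<phi> t \<noteq> 0}"
  have "compact (\<phi> ` ?K)"
    using assms by (intro compact_continuous_image) (auto simp: Cc_def intro: continuous_on_subset)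
  then obtain B where B: "\<And>t. t \<in> ?K \<Longrightarrow> \<bar>\<phi> t\<bar> \<le> B"
    using compact_imp_bounded[of "\<phi> ` ?K"] by (auto simp: bounded_iff)
  have "\<bar>\<phi> t\<bar> \<le> max B 0" for t
    using B[of t] closure_subset[of "{t. \<phi> t \<noteq> 0}"] by (cases "\<phi> t = 0") auto
  then show ?thesis
    using that by blast
qed

lemma Cc_le_SUP:
  assumes "\<phi> \<in> Cc I"
  shows "\<bar>\<phi> t\<bar> \<le> (SUP s. \<bar>\<phi> s\<bar>)"
proof -
  obtain B where "\<And>s. \<bar>\<phi> s\<bar> \<le> B"
    using Cc_bounded[OF assms] by blast
  then have "bdd_above (range (\<lambda>s. \<bar>\<phi> s\<bar>))"
    by (intro bdd_aboveI2)
  then show ?thesis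
    by (rule cSUP_upper[OF UNIV_I])
qed

lemma Cc_eq_0: "\<phi> \<in> Cc I \<Longrightarrow> t \<notin> I \<Longrightarrow> \<phi> t = 0"
  using closure_subset[of "{t. \<phi> t \<noteq> 0}"] unfolding Cc_def by blast

lemma Cc_measurable: "\<phi> \<in> Cc I \<Longrightarrow> \<phi> \<in> borel_measurable (lebesgue_on J)"
  by (rule continuous_imp_measurable_lebesgue_on) (simp add: Cc_def)

lemma Cc_smooth_deriv:
  assumes "\<phi> \<in> Cc_smooth I"
  shows "(\<phi> has_real_derivative deriv \<phi> t) (at t)" "continuous_on UNIV (deriv \<phi>)"
proof -
  have diff: "(deriv ^^ k) \<phi> field_differentiable at t" for k t
    using assms by (simp add: Cc_smooth_def)
  show "(\<phi> has_real_derivative deriv \<phi> t) (at t)"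
    using diff[of 0 t] by (simp add: DERIV_deriv_iff_field_differentiable)
  show "continuous_on UNIV (deriv \<phi>)"
    using diff[of 1] by (auto intro!: continuous_at_imp_continuous_on field_differentiable_imp_continuous_at)
qed

lemma L1_conv_integral_mult_continuous:
  fixes \<psi> :: "real \<Rightarrow> real"
  assumes "L1_conv {a<..<b} X x" "continuous_on UNIV \<psi>"
  shows "(\<lambda>k. LINT t|lebesgue_on {a<..<b}. X k t * \<psi> t) \<longlonglongrightarrow> (LINT t|lebesgue_on {a<..<b}. x t * \<psi> t)"
proof -
  obtain B where "\<And>t. t \<in> {a<..<b} \<Longrightarrow> \<bar>\<psi> t\<bar> \<le> B"
    using continuous_bounded_on_interval[OF assms(2)] by blast
  with assms(1) continuous_imp_measurable_lebesgue_on[OF assms(2)] show ?thesis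
    by (rule L1_conv_integral_mult)
qed

lemma has_weak_derivative_limit:
  assumes "\<And>k. has_weak_derivative {a<..<b} (X k) (X' k)"
    and "L1_conv {a<..<b} X x" "L1_conv {a<..<b} X' x'"
  shows "has_weak_derivative {a<..<b} x x'"
  unfolding has_weak_derivative_def
proof (intro conjI ballI)
  fix \<phi> assume \<phi>: "\<phi> \<in> Cc_smooth {a<..<b}"
  then have "continuous_on UNIV \<phi>"
    by (auto simp: Cc_smooth_def Cc_def)
  then have "(\<lambda>k. - (LINT t|lebesgue_on {a<..<b}. X' k t * \<phi> t))
      \<longlonglongrightarrow> - (LINT t|lebesgue_on {a<..<b}. x' t * \<phi> t)"
    using assms(3) by (intro tendsto_minus L1_conv_integral_mult_continuous)
  moreover have "(\<lambda>k. LINT t|lebesgue_on {a<..<b}. X k t * deriv \<phi> t)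
      \<longlonglongrightarrow> (LINT t|lebesgue_on {a<..<b}. x t * deriv \<phi> t)"
    using assms(2) Cc_smooth_deriv(2)[OF \<phi>] by (rule L1_conv_integral_mult_continuous)
  moreover have "(LINT t|lebesgue_on {a<..<b}. X k t * deriv \<phi> t)
      = - (LINT t|lebesgue_on {a<..<b}. X' k t * \<phi> t)" for k
    using assms(1) \<phi> by (simp add: has_weak_derivative_def)
  ultimately show "(LINT t|lebesgue_on {a<..<b}. x t * deriv \<phi> t)
      = - (LINT t|lebesgue_on {a<..<b}. x' t * \<phi> t)"
    using LIMSEQ_unique by auto
qed (use assms in \<open>auto simp: L1_conv_def\<close>)

text \<open>
  The sums of increments telescope after they are replaced by those of \<open>W\<close>.
\<close>

lemma BV_if_increments_bounded:
  fixes g W :: "real \<Rightarrow> real"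
  assumes incr: "\<And>s t. s \<in> I \<Longrightarrow> t \<in> I \<Longrightarrow> s \<le> t \<Longrightarrow> \<bar>g t - g s\<bar> \<le> W t - W s"
    and bound: "\<And>t. t \<in> I \<Longrightarrow> \<bar>W t\<bar> \<le> B"
  shows "g \<in> BV I"
proof -
  have "(\<Sum>i<n. \<bar>g (s (Suc i)) - g (s i)\<bar>) \<le> 2 * B"
    if s: "s ` {..n} \<subseteq> I" "mono_on {..n} s" for n s
  proof -
    have "(\<Sum>i<n. \<bar>g (s (Suc i)) - g (s i)\<bar>) \<le> (\<Sum>i<n. W (s (Suc i)) - W (s i))"
      using s by (intro sum_mono incr) (auto intro: mono_onD)
    also have "\<dots> = W (s n) - W (s 0)"
      by (rule sum_lessThan_telescope)
    also have "\<dots> \<le> 2 * B"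
      using bound[of "s n"] bound[of "s 0"] s(1) by fastforce
    finally show ?thesis .
  qed
  then show ?thesis
    unfolding BV_def by blast
qed

text \<open>
  A property that holds almost everywhere holds arbitrarily close to the left end of the interval,
  because intervals are not null sets.
\<close>

lemma AE_lebesgue_on_ex:
  assumes "AE t in lebesgue_on {a<..<b}. P t" "a < c" "c \<le> (b :: real)"
  shows "\<exists>t\<in>{a<..<c}. P t"
proof (rule ccontr)
  assume "\<not> ?thesis"
  moreover have "AE t in lebesgue. t \<in> {a<..<b} \<longrightarrow> P t"
    using assms(1) by (simp add: AE_restrict_space_iff)
  ultimately have "AE t in lebesgue. t \<notin> {a<..<c}"
    using assms(3) by (auto elim!: eventually_mono)
  then have "{a<..<c} \<in> null_sets lebesgue"
    by (simp add: AE_iff_null_sets)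
  then show False
    using assms(2) by (auto simp: null_sets_def)
qed

section \<open>Weak-\<open>\<star>\<close> compactness of densities bounded in \<open>L\<^sup>1\<close>\<close>

lemma density_form_bound:
  assumes "integrable (lebesgue_on I) g" "\<phi> \<in> borel_measurable (lebesgue_on I)" "\<And>t. t \<in> I \<Longrightarrow> \<bar>\<phi> t\<bar> \<le> B"
  shows "\<bar>density_form I g \<phi>\<bar> \<le> B * (LINT t|lebesgue_on I. \<bar>g t\<bar>)"
  using integrable_mult_bounded(2)[OF assms(1,2)] assms(3) by (simp add: density_form_def)

lemma density_form_linear:
  assumes "integrable (lebesgue_on I) g"
    and "\<phi> \<in> borel_measurable (lebesgue_on I)" "\<And>t. t \<in> I \<Longrightarrow> \<bar>\<phi> t\<bar> \<le> B"
    and "\<psi> \<in> borel_measurable (lebesgue_on I)" "\<And>t. t \<in> I \<Longrightarrow> \<bar>\<psi> t\<bar> \<le> C"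
  shows "density_form I g (\<lambda>t. \<phi> t + \<psi> t) = density_form I g \<phi> + density_form I g \<psi>"
    "density_form I g (\<lambda>t. \<phi> t - \<psi> t) = density_form I g \<phi> - density_form I g \<psi>"
proof -
  have int: "integrable (lebesgue_on I) (\<lambda>t. g t * \<phi> t)" "integrable (lebesgue_on I) (\<lambda>t. g t * \<psi> t)"
    using integrable_mult_bounded(1)[OF assms(1)] assms(2-5) by auto
  show "density_form I g (\<lambda>t. \<phi> t + \<psi> t) = density_form I g \<phi> + density_form I g \<psi>"
    "density_form I g (\<lambda>t. \<phi> t - \<psi> t) = density_form I g \<phi> - density_form I g \<psi>"
    using int by (simp_all add: density_form_def ring_distribs)
qed

lemma density_form_in_measures_on:
  assumes "integrable (lebesgue_on I) g"
  shows "density_form I g \<in> measures_on I"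
  unfolding measures_on_def mem_Collect_eq
proof (intro conjI ballI allI exI)
  fix \<phi> \<psi> c assume \<phi>: "\<phi> \<in> Cc I"
  show "\<bar>density_form I g \<phi>\<bar> \<le> (LINT t|lebesgue_on I. \<bar>g t\<bar>) * (SUP t. \<bar>\<phi> t\<bar>)"
    using density_form_bound[OF assms Cc_measurable[OF \<phi>] Cc_le_SUP[OF \<phi>]] by (simp add: mult.commute)
  show "density_form I g (\<lambda>t. c * \<phi> t) = c * density_form I g \<phi>"
    by (simp add: density_form_def mult.left_commute)
  assume \<psi>: "\<psi> \<in> Cc I"
  show "density_form I g (\<lambda>t. \<phi> t + \<psi> t) = density_form I g \<phi> + density_form I g \<psi>"
    using density_form_linear(1)[OF assms Cc_measurable[OF \<phi>] Cc_le_SUP[OF \<phi>] Cc_measurable[OF \<psi>] Cc_le_SUP[OF \<psi>]] .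
qed

text \<open>
  A polynomial that is uniformly close to \<open>\<phi>\<close> has small values at the ends of the interval, since \<open>\<phi>\<close>
  vanishes there. Subtracting the affine function with these end values makes it vanish at the ends
  and is a small perturbation.
\<close>

lemma Cc_approx_polynomial:
  assumes "T > 0" "\<phi> \<in> Cc {0<..<T}" "e > 0"
  obtains p p' :: "real \<Rightarrow> real" where "\<And>t. (p has_real_derivative p' t) (at t)" "continuous_on UNIV p'"
    "p 0 = 0" "p T = 0" "\<And>t. t \<in> {0..T} \<Longrightarrow> \<bar>\<phi> t - p t\<bar> \<le> e"
proof -
  have "continuous_on {0..T} \<phi>"
    using assms(2) by (auto simp: Cc_def intro: continuous_on_subset)
  then obtain r where r: "real_polynomial_function r" "\<And>t. t \<in> {0..T} \<Longrightarrow> \<bar>\<phi> t - r t\<bar> < e / 3"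
    using Stone_Weierstrass_real_polynomial_function[of "{0..T}" \<phi> "e / 3"] assms(3) by auto
  obtain r' where r': "real_polynomial_function r'" "\<And>t. (r has_real_derivative r' t) (at t)"
    using has_real_derivative_polynomial_function[OF r(1)] by blast
  define p where "p t = r t - (r 0 + t / T * (r T - r 0))" for t
  define p' where "p' t = r' t - (r T - r 0) / T" for t
  have ends: "\<bar>r 0\<bar> < e / 3" "\<bar>r T\<bar> < e / 3"
    using r(2)[of 0] r(2)[of T] Cc_eq_0[OF assms(2), of 0] Cc_eq_0[OF assms(2), of T] assms(1) by auto
  show ?thesis
  proof
    show "(p has_real_derivative p' t) (at t)" for t
      unfolding p_def p'_def using assms(1) by (auto intro!: derivative_eq_intros r'(2))
    show "continuous_on UNIV p'"
      unfolding p'_def using r'(1)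
      by (intro continuous_intros continuous_on_polymonial_function) (simp add: real_polynomial_function_eq)
    show "p 0 = 0" "p T = 0"
      using assms(1) by (auto simp: p_def)
    show "\<bar>\<phi> t - p t\<bar> \<le> e" if t: "t \<in> {0..T}" for t
    proof -
      define c where "c = (1 - t / T) * r 0 + t / T * r T"
      have "0 \<le> t / T" "t / T \<le> 1"
        using t assms(1) by auto
      then have "\<bar>c\<bar> \<le> (1 - t / T) * (e / 3) + t / T * (e / 3)"
        unfolding c_def using ends by (intro abs_convex_combination_le) simp_all
      moreover have "(1 - t / T) * (e / 3) + t / T * (e / 3) = e / 3"
        unfolding distrib_right[symmetric] by simp
      moreover have "p t = r t - c"
        unfolding p_def c_def left_diff_distrib right_diff_distrib by simp
      ultimately show ?thesis
        using r(2)[OF t] assms(3) by linarith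
    qed
  qed
qed

text \<open>
  The functionals are equicontinuous for the supremum norm, so convergence on test functions that
  are dense in \<open>C\<^sub>c(I)\<close> implies that the values on every element of \<open>C\<^sub>c(I)\<close> form a Cauchy sequence. Test
  functions that vanish at the ends of \<open>I\<close> are those for which integration by parts leaves no boundary
  terms.
\<close>

lemma weak_star_compactness:
  assumes "T > 0"
    and int: "\<And>k. integrable (lebesgue_on {0<..<T}) (X k)"
    and bound: "\<And>k. (LINT t|lebesgue_on {0<..<T}. \<bar>X k t\<bar>) \<le> C"
    and conv: "\<And>p p'. (\<And>t. (p has_real_derivative p' t) (at t)) \<Longrightarrow> continuous_on UNIV p' \<Longrightarrow>
      p 0 = 0 \<Longrightarrow> p T = 0 \<Longrightarrow> convergent (\<lambda>k. density_form {0<..<T} (X k) p)"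
  obtains \<Lambda> where "weak_star_conv {0<..<T} (\<lambda>k. density_form {0<..<T} (X k)) \<Lambda>"
proof -
  let ?I = "{0<..<T}"
  let ?D = "\<lambda>k. density_form ?I (X k)"
  have C: "C \<ge> 0"
    using bound[of 0] by (rule order_trans[rotated]) simp
  have conv': "convergent (\<lambda>k. ?D k \<phi>)" if \<phi>: "\<phi> \<in> Cc ?I" for \<phi>
  proof (intro real_Cauchy_convergent CauchyI)
    fix e :: real assume "e > 0"
    (* Two approximation errors of size d C stay below 2 e / 3; the summand 1 covers C = 0. *)
    define d where "d = e / (3 * (C + 1))"
    have "d > 0" and d: "2 * (d * C) < 2 * e / 3"
      using \<open>e > 0\<close> C by (auto simp: d_def field_simps)
    obtain p p' where p: "\<And>t. (p has_real_derivative p' t) (at t)" "continuous_on UNIV p'"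
        "p 0 = 0" "p T = 0" "\<And>t. t \<in> {0..T} \<Longrightarrow> \<bar>\<phi> t - p t\<bar> \<le> d"
      using Cc_approx_polynomial[OF assms(1) \<phi> \<open>d > 0\<close>] by blast
    have cont: "continuous_on UNIV p"
      using p(1) by (meson DERIV_isCont continuous_at_imp_continuous_on)
    obtain B where B: "\<And>t. t \<in> ?I \<Longrightarrow> \<bar>p t\<bar> \<le> B"
      using continuous_bounded_on_interval[OF cont] by blast
    have approx: "\<bar>?D k \<phi> - ?D k p\<bar> \<le> d * C" for k
    proof -
      have "?D k \<phi> - ?D k p = ?D k (\<lambda>t. \<phi> t - p t)"
        using density_form_linear(2)[OF int Cc_measurable[OF \<phi>] Cc_le_SUP[OF \<phi>]
          continuous_imp_measurable_lebesgue_on[OF cont] B] by simp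
      also have "\<bar>\<dots>\<bar> \<le> d * (LINT t|lebesgue_on ?I. \<bar>X k t\<bar>)"
        using p(5) by (intro density_form_bound int borel_measurable_diff Cc_measurable[OF \<phi>]
          continuous_imp_measurable_lebesgue_on[OF cont]) auto
      also have "\<dots> \<le> d * C"
        using bound \<open>d > 0\<close> by (intro mult_left_mono) auto
      finally show ?thesis .
    qed
    have "Cauchy (\<lambda>k. ?D k p)"
      using conv[OF p(1-4)] by (rule convergent_Cauchy)
    then have "\<exists>M. \<forall>i\<ge>M. \<forall>j\<ge>M. norm (?D i p - ?D j p) < e / 3"
      using CauchyD[of "\<lambda>k. ?D k p" "e / 3"] \<open>e > 0\<close> by simp
    then obtain M where M: "\<And>i j. i \<ge> M \<Longrightarrow> j \<ge> M \<Longrightarrow> norm (?D i p - ?D j p) < e / 3"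
      by blast
    have "norm (?D i \<phi> - ?D j \<phi>) < e" if "i \<ge> M" "j \<ge> M" for i j
      using approx[of i] approx[of j] M[OF that] d unfolding real_norm_def by linarith
    then show "\<exists>M. \<forall>i\<ge>M. \<forall>j\<ge>M. norm (?D i \<phi> - ?D j \<phi>) < e"
      by blast
  qed
  define \<Lambda> where "\<Lambda> \<phi> = lim (\<lambda>k. ?D k \<phi>)" for \<phi>
  have lim: "(\<lambda>k. ?D k \<phi>) \<longlonglongrightarrow> \<Lambda> \<phi>" if "\<phi> \<in> Cc ?I" for \<phi>
    using conv'[OF that] by (simp add: \<Lambda>_def convergent_LIMSEQ_iff)
  have meas: "?D k \<in> measures_on ?I" for k
    using int by (rule density_form_in_measures_on)
  have "\<Lambda> \<in> measures_on ?I"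
    unfolding measures_on_def mem_Collect_eq
  proof (intro conjI ballI allI exI)
    fix \<phi> \<psi> c assume \<phi>: "\<phi> \<in> Cc ?I"
    show "\<bar>\<Lambda> \<phi>\<bar> \<le> C * (SUP t. \<bar>\<phi> t\<bar>)"
    proof (rule LIMSEQ_le_const2[OF tendsto_rabs[OF lim[OF \<phi>]]], intro exI allI impI)
      fix k
      have "\<bar>?D k \<phi>\<bar> \<le> (SUP t. \<bar>\<phi> t\<bar>) * (LINT t|lebesgue_on ?I. \<bar>X k t\<bar>)"
        by (rule density_form_bound[OF int Cc_measurable[OF \<phi>] Cc_le_SUP[OF \<phi>]])
      also have "\<dots> \<le> (SUP t. \<bar>\<phi> t\<bar>) * C"
        using order_trans[OF abs_ge_zero Cc_le_SUP[OF \<phi>, of 0]] bound by (intro mult_left_mono) auto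
      finally show "\<bar>?D k \<phi>\<bar> \<le> C * (SUP t. \<bar>\<phi> t\<bar>)"
        by (simp add: mult.commute)
    qed
    have "?D k (\<lambda>t. c * \<phi> t) = c * ?D k \<phi>" for k
      by (simp add: density_form_def mult.left_commute)
    then show "\<Lambda> (\<lambda>t. c * \<phi> t) = c * \<Lambda> \<phi>"
      unfolding \<Lambda>_def using tendsto_mult_left[OF lim[OF \<phi>], of c] by (simp add: limI \<Lambda>_def)
    assume \<psi>: "\<psi> \<in> Cc ?I"
    have "?D k (\<lambda>t. \<phi> t + \<psi> t) = ?D k \<phi> + ?D k \<psi>" for k
      by (rule density_form_linear(1)[OF int Cc_measurable[OF \<phi>] Cc_le_SUP[OF \<phi>]
            Cc_measurable[OF \<psi>] Cc_le_SUP[OF \<psi>]])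
    then show "\<Lambda> (\<lambda>t. \<phi> t + \<psi> t) = \<Lambda> \<phi> + \<Lambda> \<psi>"
      unfolding \<Lambda>_def using tendsto_add[OF lim[OF \<phi>] lim[OF \<psi>]] by (simp add: limI \<Lambda>_def)
  qed
  then show ?thesis
    using that[of \<Lambda>] meas lim by (simp add: weak_star_conv_def)
qed

section \<open>Derivatives of piecewise affine functions\<close>

definition slope_interp :: "real \<Rightarrow> (nat \<Rightarrow> real) \<Rightarrow> real \<Rightarrow> real" where
  "slope_interp h a t = (a (Suc (cell h t)) - a (cell h t)) / h"

lemma affine_interp_has_derivative:
  assumes "h > 0" "t > 0" "t \<notin> (\<lambda>n. real n * h) ` A" "cell h t \<in> A"
  shows "(affine_interp h a has_vector_derivative slope_interp h a t) (at t)"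
proof -
  let ?n = "cell h t"
  have "real ?n * h \<noteq> t"
    using assms(3,4) by (metis imageI)
  then have t: "t \<in> {real ?n * h<..<real (Suc ?n) * h}"
    using cell_bounds[of h t] assms by auto
  have "((\<lambda>t. a ?n + (t - real ?n * h) / h * (a (Suc ?n) - a ?n)) has_vector_derivative slope_interp h a t) (at t)"
    unfolding slope_interp_def has_real_derivative_iff_has_vector_derivative[symmetric]
    using assms(1) by (auto intro!: derivative_eq_intros)
  then show ?thesis
  proof (rule has_vector_derivative_transform_within_open[OF _ open_greaterThanLessThan t])
    show "a ?n + (s - real ?n * h) / h * (a (Suc ?n) - a ?n) = affine_interp h a s"
      if "s \<in> {real ?n * h<..<real (Suc ?n) * h}" for s
      using that assms(1) affine_interp_eq[of h ?n s a] by simp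
  qed
qed

lemma has_integral_slope_interp:
  assumes "h > 0" "0 \<le> t" "t \<le> real N * h"
  shows "(slope_interp h a has_integral affine_interp h a t - a 0) {0..t}"
proof -
  have "(slope_interp h a has_integral affine_interp h a t - affine_interp h a 0) {0..t}"
  proof (rule fundamental_theorem_of_calculus_interior_strong[of "(\<lambda>n. real n * h) ` {..<N}"])
    show "continuous_on {0..t} (affine_interp h a)"
      using assms by (intro continuous_on_subset[OF continuous_on_affine_interp[of h N]]) auto
    show "(affine_interp h a has_vector_derivative slope_interp h a x) (at x)"
      if "x \<in> {0<..<t} - (\<lambda>n. real n * h) ` {..<N}" for x
      using that assms by (intro affine_interp_has_derivative[of _ _ "{..<N}"]) (auto intro!: cell_less)
  qed (use assms in auto)
  then show ?thesis
    using affine_interp_node[OF assms(1), of a 0] by simp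
qed

text \<open>
  The product of \<open>\<phi>\<close> with an interpolant is continuous and differentiable outside the nodes, which
  are finitely many; the fundamental theorem of calculus allows such exceptions.
\<close>

lemma affine_interp_by_parts:
  assumes "h > 0"
    and deriv: "\<And>t. t \<in> {0..real N * h} \<Longrightarrow> (\<phi> has_real_derivative \<phi>' t) (at t)"
    and "\<phi> 0 = 0" "\<phi> (real N * h) = 0"
  shows "((\<lambda>t. affine_interp h a t * \<phi>' t + slope_interp h a t * \<phi> t) has_integral 0) {0..real N * h}"
proof -
  let ?F = "\<lambda>t. affine_interp h a t * \<phi> t"
  have "((\<lambda>t. affine_interp h a t * \<phi>' t + slope_interp h a t * \<phi> t)
      has_integral ?F (real N * h) - ?F 0) {0..real N * h}"
  proof (rule fundamental_theorem_of_calculus_interior_strong[of "(\<lambda>n. real n * h) ` {..<N}"])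
    have "continuous_on {0..real N * h} \<phi>"
      using deriv by (meson DERIV_continuous_on DERIV_subset subset_UNIV)
    then show "continuous_on {0..real N * h} ?F"
      using assms(1) by (intro continuous_intros continuous_on_affine_interp)
    show "(?F has_vector_derivative affine_interp h a x * \<phi>' x + slope_interp h a x * \<phi> x) (at x)"
      if "x \<in> {0<..<real N * h} - (\<lambda>n. real n * h) ` {..<N}" for x
    proof -
      have "(affine_interp h a has_vector_derivative slope_interp h a x) (at x)"
        using that assms(1) by (intro affine_interp_has_derivative[of _ _ "{..<N}"]) (auto intro!: cell_less)
      moreover have "(\<phi> has_vector_derivative \<phi>' x) (at x)"
        using that deriv by (auto simp: has_real_derivative_iff_has_vector_derivative)
      ultimately show ?thesis
        by (rule has_vector_derivative_mult)
    qed
  qed (use assms in auto)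
  then show ?thesis
    using assms(3,4) by simp
qed

lemma cell_measurable [measurable]: "cell h \<in> borel \<rightarrow>\<^sub>M count_space UNIV"
  unfolding cell_def by measurable

lemma step_function_integrable:
  fixes c :: "nat \<Rightarrow> real"
  assumes "h > 0"
  shows "integrable (lebesgue_on {0<..<real N * h}) (\<lambda>t. c (cell h t))"
proof -
  interpret finite_measure "lebesgue_on {0<..<real N * h}"
    by (intro finite_measure_lebesgue_on) auto
  have "(\<lambda>t. c (cell h t)) \<in> borel_measurable borel"
    by measurable
  then have "(\<lambda>t. c (cell h t)) \<in> borel_measurable (lebesgue_on {0<..<real N * h})"
    by (intro measurable_restrict_space1 measurable_completion) simp
  then show ?thesis
  proof (intro integrable_const_bound[of _ "\<Sum>n<N. \<bar>c n\<bar>"] AE_I2)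
    fix t assume "t \<in> space (lebesgue_on {0<..<real N * h})"
    then have "cell h t < N"
      using assms by (intro cell_less) auto
    then show "norm (c (cell h t)) \<le> (\<Sum>n<N. \<bar>c n\<bar>)"
      by (auto intro!: member_le_sum[of "cell h t" "{..<N}" "\<lambda>n. \<bar>c n\<bar>"])
  qed auto
qed

text \<open>
  A step function is the slope of the interpolant of its partial sums, so its integral is the
  increment of that interpolant.
\<close>

lemma integral_step_function:
  fixes c :: "nat \<Rightarrow> real"
  assumes "h > 0"
  shows "(LINT t|lebesgue_on {0<..<real N * h}. c (cell h t)) = h * (\<Sum>n<N. c n)"
proof -
  (* The sequence whose slope is the given step function. *)
  define a where "a n = h * (\<Sum>k<n. c k)" for n
  have "slope_interp h a = (\<lambda>t. c (cell h t))"
    using assms by (auto simp: slope_interp_def a_def fun_eq_iff field_simps)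
  with has_integral_slope_interp[OF assms, of "real N * h" N a] assms
  have "((\<lambda>t. c (cell h t)) has_integral a N) {0..real N * h}"
    by (simp add: affine_interp_node a_def)
  then have "integral {0<..<real N * h} (\<lambda>t. c (cell h t)) = a N"
    by (metis integral_open_interval_real integral_unique)
  then show ?thesis
    using lebesgue_integral_eq_integral[OF step_function_integrable[OF assms, of N c]]
    by (simp add: a_def)
qed

lemma affine_interp_integrable:
  "h > 0 \<Longrightarrow> integrable (lebesgue_on {0<..<real N * h}) (affine_interp h a)"
  by (intro continuous_imp_integrable_Ioo continuous_on_affine_interp)

lemma slope_interp_integrable:
  assumes "h > 0"
  shows "integrable (lebesgue_on {0<..<real N * h}) (slope_interp h a)"
  using step_function_integrable[OF assms, of N "\<lambda>n. (a (Suc n) - a n) / h"]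
  by (simp add: slope_interp_def[abs_def])

lemma affine_interp_by_parts_lebesgue:
  assumes "h > 0"
    and "\<And>t. (\<phi> has_real_derivative \<phi>' t) (at t)" "continuous_on UNIV \<phi>'"
    and "\<phi> 0 = 0" "\<phi> (real N * h) = 0"
  shows "(LINT t|lebesgue_on {0<..<real N * h}. affine_interp h a t * \<phi>' t)
    = - (LINT t|lebesgue_on {0<..<real N * h}. slope_interp h a t * \<phi> t)"
proof -
  let ?M = "lebesgue_on {0<..<real N * h}"
  have cont: "continuous_on UNIV \<phi>"
    using assms(2) by (meson DERIV_isCont continuous_at_imp_continuous_on)
  obtain B where B: "\<And>t. t \<in> {0<..<real N * h} \<Longrightarrow> \<bar>\<phi> t\<bar> \<le> B"
    using continuous_bounded_on_interval[OF cont] by blast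
  obtain B' where B': "\<And>t. t \<in> {0<..<real N * h} \<Longrightarrow> \<bar>\<phi>' t\<bar> \<le> B'"
    using continuous_bounded_on_interval[OF assms(3)] by blast
  have int: "integrable ?M (\<lambda>t. affine_interp h a t * \<phi>' t)" "integrable ?M (\<lambda>t. slope_interp h a t * \<phi> t)"
    using integrable_mult_bounded(1)[OF affine_interp_integrable[OF assms(1), of N a]
        continuous_imp_measurable_lebesgue_on[OF assms(3)], of B']
      integrable_mult_bounded(1)[OF slope_interp_integrable[OF assms(1), of N a]
        continuous_imp_measurable_lebesgue_on[OF cont], of B] B B'
    by auto
  let ?f = "\<lambda>t. affine_interp h a t * \<phi>' t + slope_interp h a t * \<phi> t"
  have "(?f has_integral 0) {0..real N * h}"
    using assms by (intro affine_interp_by_parts) auto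
  then have "integral {0<..<real N * h} ?f = 0"
    by (metis integral_open_interval_real integral_unique)
  moreover have "integral\<^sup>L ?M ?f = integral {0<..<real N * h} ?f"
    using int by (intro lebesgue_integral_eq_integral) auto
  ultimately show ?thesis
    using int by simp
qed

lemma affine_interp_has_weak_derivative:
  assumes "h > 0" "N > 0"
  shows "has_weak_derivative {0<..<real N * h} (affine_interp h a) (slope_interp h a)"
  unfolding has_weak_derivative_def
proof (intro conjI ballI)
  fix \<phi> assume \<phi>: "\<phi> \<in> Cc_smooth {0<..<real N * h}"
  then have "\<phi> 0 = 0" "\<phi> (real N * h) = 0"
    using Cc_eq_0[of \<phi>] by (auto simp: Cc_smooth_def)
  then show "(LINT t|lebesgue_on {0<..<real N * h}. affine_interp h a t * deriv \<phi> t)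
    = - (LINT t|lebesgue_on {0<..<real N * h}. slope_interp h a t * \<phi> t)"
    using Cc_smooth_deriv[OF \<phi>] assms by (intro affine_interp_by_parts_lebesgue) auto
qed (use assms in \<open>auto intro: affine_interp_integrable slope_interp_integrable\<close>)
section \<open>Estimates uniform in the time step\<close>

locale particle_plane =
  fixes T m q0 u0 :: real and f :: "real \<Rightarrow> real"
  assumes T_pos: "T > 0" and m_pos: "m > 0" and q0_pos: "q0 > 0"
    and f_integrable: "integrable (lebesgue_on {0<..<T}) f"
begin

text \<open>
  The velocity of a particle that meets no plane.
\<close>

definition g :: "real \<Rightarrow> real" where "g t = u0 + integral {0..t} f"
definition V :: "real \<Rightarrow> real" where "V t = integral {0..t} (\<lambda>s. \<bar>f s\<bar>)"
text \<open>
  A bound for the free velocity; the estimates below are expressed in terms of it.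
\<close>

definition M :: real where "M = \<bar>u0\<bar> + V T"

lemma f_integrable_on: "f integrable_on {0..T}" "(\<lambda>s. \<bar>f s\<bar>) integrable_on {0..T}"
proof -
  have "f absolutely_integrable_on {0<..<T}"
    using f_integrable by (simp add: set_integrable_def integrable_restrict_space)
  then have "f absolutely_integrable_on {0..T}"
    by (simp add: absolutely_integrable_on_Icc_iff_Ioo)
  then show "f integrable_on {0..T}" "(\<lambda>s. \<bar>f s\<bar>) integrable_on {0..T}"
    by (auto simp: absolutely_integrable_on_def)
qed

lemma continuous_g: "continuous_on {0..T} g" and continuous_V: "continuous_on {0..T} V"
  unfolding g_def V_def
  by (intro continuous_intros indefinite_integral_continuous_1 f_integrable_on)+

lemma g_0: "g 0 = u0" and V_0: "V 0 = 0"
  by (simp_all add: g_def V_def)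

lemma g_diff:
  assumes "0 \<le> s" "s \<le> t" "t \<le> T"
  shows "g t - g s = integral {s..t} f" "\<bar>g t - g s\<bar> \<le> V t - V s"
proof -
  have int: "f integrable_on {0..t}" "(\<lambda>s. \<bar>f s\<bar>) integrable_on {0..t}"
    "f integrable_on {s..t}" "(\<lambda>s. \<bar>f s\<bar>) integrable_on {s..t}"
    using assms f_integrable_on by (auto intro: integrable_subinterval_real)
  have g: "integral {0..s} f + integral {s..t} f = integral {0..t} f"
    and V: "integral {0..s} (\<lambda>s. \<bar>f s\<bar>) + integral {s..t} (\<lambda>s. \<bar>f s\<bar>) = integral {0..t} (\<lambda>s. \<bar>f s\<bar>)"
    using assms int by (auto intro!: Henstock_Kurzweil_Integration.integral_combine)
  show 1: "g t - g s = integral {s..t} f"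
    using g by (simp add: g_def)
  have "\<bar>integral {s..t} f\<bar> \<le> integral {s..t} (\<lambda>s. \<bar>f s\<bar>)"
    using integral_norm_bound_integral[OF int(3,4)] by simp
  then show "\<bar>g t - g s\<bar> \<le> V t - V s"
    unfolding 1 using V by (simp add: V_def)
qed

lemma V_mono: "0 \<le> s \<Longrightarrow> s \<le> t \<Longrightarrow> t \<le> T \<Longrightarrow> V s \<le> V t"
  using g_diff(2)[of s t] by linarith

lemma V_bounds: "0 \<le> t \<Longrightarrow> t \<le> T \<Longrightarrow> 0 \<le> V t \<and> V t \<le> M"
  using V_mono[of 0 t] V_mono[of t T] V_0 by (auto simp: M_def)

lemma M_nonneg: "M \<ge> 0"
  using V_bounds[of 0] T_pos by auto

lemma g_bound: "0 \<le> t \<Longrightarrow> t \<le> T \<Longrightarrow> \<bar>g t\<bar> \<le> M"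
  using g_diff(2)[of 0 t] V_mono[of t T] V_0 g_0 unfolding M_def by linarith

lemma integral_force_eq: "0 < t \<Longrightarrow> t \<le> T \<Longrightarrow> u0 + (LINT s|lebesgue_on {0<..<t}. f s) = g t"
  and average_force_eq: "h > 0 \<Longrightarrow> real (Suc n) * h \<le> T \<Longrightarrow>
    h * average_force h f n = g (real (Suc n) * h) - g (real n * h)"
proof -
  have eq: "(LINT s|lebesgue_on {a<..<b}. f s) = integral {a..b} f" if "0 \<le> a" "b \<le> T" for a b
  proof -
    have "set_integrable lebesgue {0<..<T} f"
      using f_integrable by (simp add: set_integrable_def integrable_restrict_space)
    then have "set_integrable lebesgue {a<..<b} f"
      by (rule set_integrable_subset) (use that in auto)
    then have "integrable (lebesgue_on {a<..<b}) f"
      by (simp add: set_integrable_def integrable_restrict_space)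
    then show ?thesis
      by (simp add: lebesgue_integral_eq_integral integral_open_interval_real)
  qed
  show "u0 + (LINT s|lebesgue_on {0<..<t}. f s) = g t" if "0 < t" "t \<le> T"
    using eq[of 0 t] that by (simp add: g_def)
  show "h * average_force h f n = g (real (Suc n) * h) - g (real n * h)"
    if "h > 0" "real (Suc n) * h \<le> T"
    using eq[of "real n * h" "real (Suc n) * h"] g_diff(1)[of "real n * h" "real (Suc n) * h"] that
    by (simp add: average_force_def mult_right_mono)
qed

definition h :: "nat \<Rightarrow> real" where "h N = T / real N"
abbreviation qn :: "nat \<Rightarrow> nat \<Rightarrow> real" where "qn N \<equiv> algo_q m (h N) f q0 u0"
abbreviation un :: "nat \<Rightarrow> nat \<Rightarrow> real" where "un N \<equiv> algo_u m (h N) f q0 u0"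
abbreviation \<gamma>n :: "nat \<Rightarrow> nat \<Rightarrow> real" where "\<gamma>n N \<equiv> algo_gamma m (h N) f q0 u0"

lemma h_pos: "N \<ge> 1 \<Longrightarrow> h N > 0"
  using T_pos by (simp add: h_def)

lemma N_h: "N \<ge> 1 \<Longrightarrow> real N * h N = T"
  by (simp add: h_def)

lemma node_le:
  assumes "N \<ge> 1" "n \<le> N"
  shows "real n * h N \<le> T"
  using assms T_pos by (simp add: h_def field_simps)

lemma node_nonneg: "0 \<le> real n * h N"
  using T_pos by (simp add: h_def)

lemma cell_h_less: "N \<ge> 1 \<Longrightarrow> t \<in> {0<..<T} \<Longrightarrow> cell (h N) t < N"
  using cell_less[OF h_pos, of N t N] N_h[of N] by simp

lemma contact_state_n: "N \<ge> 1 \<Longrightarrow> contact_state (qn N n) (un N n) (\<gamma>n N n)"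
  using algo_contact_state[OF m_pos h_pos, of N q0] q0_pos by simp

lemma qn_nonneg: "N \<ge> 1 \<Longrightarrow> qn N n \<ge> 0" and \<gamma>n_nonpos: "N \<ge> 1 \<Longrightarrow> \<gamma>n N n \<le> 0"
  using contact_state_n[of N n] by (auto simp: contact_state_def)

text \<open>
  The increments of \<open>m u + \<gamma>\<close> are those of \<open>m g\<close>, and both sides equal \<open>m u\<^sup>0\<close> at the start.
\<close>

lemma conservation:
  assumes "N \<ge> 1" "n \<le> N"
  shows "m * un N n + \<gamma>n N n = m * g (real n * h N)"
  using assms(2)
proof (induction n)
  case 0
  then show ?case
    by (simp add: algo_u_def algo_gamma_def g_0)
next
  case (Suc n)
  have "h N * average_force (h N) f n = g (real (Suc n) * h N) - g (real n * h N)"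
    using Suc assms by (intro average_force_eq h_pos node_le) auto
  then have "m * un N (Suc n) + \<gamma>n N (Suc n)
      = m * un N n + \<gamma>n N n + m * (g (real (Suc n) * h N) - g (real n * h N))"
    using algo_Suc(2)[OF m_pos h_pos[OF assms(1)], of q0 f u0 n] q0_pos by simp
  then show ?case
    using Suc by (simp add: right_diff_distrib)
qed

lemma \<gamma>n_increment:
  assumes "N \<ge> 1" "n < N"
  shows "\<gamma>n N (Suc n) - \<gamma>n N n \<le> m * (V (real (Suc n) * h N) - V (real n * h N))"
proof -
  have "h N * average_force (h N) f n = g (real (Suc n) * h N) - g (real n * h N)"
    using assms by (intro average_force_eq h_pos node_le) auto
  then have "\<gamma>n N (Suc n) - \<gamma>n N n \<le> m * \<bar>g (real (Suc n) * h N) - g (real n * h N)\<bar>"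
    using algo_Suc(3)[OF m_pos h_pos[OF assms(1)], of q0 f u0 n] q0_pos by simp
  also have "\<dots> \<le> m * (V (real (Suc n) * h N) - V (real n * h N))"
    using m_pos h_pos[OF assms(1)] node_le[OF assms(1), of "Suc n"] assms(2) node_nonneg
    by (intro mult_left_mono g_diff mult_right_mono) auto
  finally show ?thesis .
qed

text \<open>
  In contact \<open>u \<le> 0\<close>, so \<open>conservation\<close> bounds \<open>\<gamma>\<close> from below by the free momentum; the upper bound
  is \<open>0\<close>.
\<close>

lemma \<gamma>n_bound:
  assumes "N \<ge> 1" "n \<le> N"
  shows "\<bar>\<gamma>n N n\<bar> \<le> m * M"
proof (cases "\<gamma>n N n < 0")
  case True
  then have "un N n \<le> 0"
    using contact_state_n[OF assms(1), of n] by (auto simp: contact_state_def)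
  then have "m * un N n \<le> 0"
    using m_pos by (simp add: mult_nonneg_nonpos)
  then have "\<gamma>n N n \<ge> m * g (real n * h N)"
    using conservation[OF assms] by linarith
  moreover have "m * (- M) \<le> m * g (real n * h N)"
    using g_bound[OF node_nonneg node_le[OF assms]] m_pos by (intro mult_left_mono) auto
  ultimately show ?thesis
    using True by simp
next
  case False
  then show ?thesis
    using \<gamma>n_nonpos[OF assms(1), of n] m_pos M_nonneg by simp
qed

lemma un_bound:
  assumes "N \<ge> 1" "n \<le> N"
  shows "\<bar>un N n\<bar> \<le> 2 * M"
proof -
  have "m * un N n = m * g (real n * h N) - \<gamma>n N n"
    using conservation[OF assms] by simp
  moreover have "\<bar>m * g (real n * h N)\<bar> \<le> m * M"
    using g_bound[OF node_nonneg node_le[OF assms]] m_pos by (simp add: abs_mult)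
  ultimately have "\<bar>m * un N n\<bar> \<le> m * (2 * M)"
    using \<gamma>n_bound[OF assms] by linarith
  then show ?thesis
    using m_pos by (simp add: abs_mult)
qed

text \<open>
  A bounded sequence whose upward increments are controlled by those of a monotone one has bounded
  variation, as the downward increments can be at most the upward ones plus the net decrease.
\<close>

lemma \<gamma>n_total_variation:
  assumes "N \<ge> 1"
  shows "(\<Sum>n<N. \<bar>\<gamma>n N (Suc n) - \<gamma>n N n\<bar>) \<le> 3 * (m * M)"
proof -
  let ?v = "\<lambda>n. m * V (real n * h N)"
  define w where "w n = 2 * ?v n - \<gamma>n N n" for n
  have abs_le: "\<bar>x\<bar> \<le> 2 * a - x" if "0 \<le> a" "x \<le> a" for a x :: real
    using that by linarith
  have "\<bar>\<gamma>n N (Suc n) - \<gamma>n N n\<bar> \<le> w (Suc n) - w n" if "n < N" for n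
  proof -
    have "V (real n * h N) \<le> V (real (Suc n) * h N)"
      using h_pos[OF assms] node_le[OF assms, of "Suc n"] that node_nonneg
      by (intro V_mono mult_right_mono) auto
    then have "0 \<le> ?v (Suc n) - ?v n"
      using m_pos by simp
    moreover have "\<gamma>n N (Suc n) - \<gamma>n N n \<le> ?v (Suc n) - ?v n"
      using \<gamma>n_increment[OF assms that] by (simp add: right_diff_distrib)
    ultimately have "\<bar>\<gamma>n N (Suc n) - \<gamma>n N n\<bar>
        \<le> 2 * (?v (Suc n) - ?v n) - (\<gamma>n N (Suc n) - \<gamma>n N n)"
      by (rule abs_le)
    also have "\<dots> = w (Suc n) - w n"
      by (simp add: w_def algebra_simps)
    finally show ?thesis .
  qed
  then have "(\<Sum>n<N. \<bar>\<gamma>n N (Suc n) - \<gamma>n N n\<bar>) \<le> (\<Sum>n<N. w (Suc n) - w n)"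
    by (intro sum_mono) auto
  also have "\<dots> = w N - w 0"
    by (rule sum_lessThan_telescope)
  also have "\<dots> = 2 * (m * V T) - \<gamma>n N N"
    using N_h[OF assms] V_0 by (simp add: w_def algo_gamma_def)
  also have "\<dots> \<le> 2 * (m * M) + m * M"
  proof -
    have "m * V T \<le> m * M"
      using V_bounds[of T] T_pos m_pos by simp
    then show ?thesis
      using \<gamma>n_bound[OF assms order_refl] by linarith
  qed
  finally show ?thesis
    by simp
qed

section \<open>Estimates for the interpolated functions\<close>

abbreviation "qh N \<equiv> q_interp m (h N) f q0 u0"
abbreviation "uh N \<equiv> u_interp m (h N) f q0 u0"
abbreviation "\<gamma>h N \<equiv> gamma_interp m (h N) f q0 u0"
abbreviation "lamh N \<equiv> lambda_interp m (h N) f q0 u0"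

lemma uh_eq_slope: "N \<ge> 1 \<Longrightarrow> uh N = slope_interp (h N) (qn N)"
  using algo_Suc(1)[OF m_pos h_pos, of N q0 f u0] q0_pos h_pos[of N] T_pos
  by (simp add: fun_eq_iff u_interp_def slope_interp_def)

lemma lamh_eq_slope: "lamh N = (\<lambda>t. - slope_interp (h N) (\<gamma>n N) t)"
  by (simp add: fun_eq_iff diff_divide_distrib lambda_interp_def slope_interp_def Let_def)

lemma interp_integrable:
  assumes "N \<ge> 1"
  shows "integrable (lebesgue_on {0<..<T}) (qh N)" "integrable (lebesgue_on {0<..<T}) (uh N)"
    "integrable (lebesgue_on {0<..<T}) (\<gamma>h N)" "integrable (lebesgue_on {0<..<T}) (lamh N)"
  using affine_interp_integrable[OF h_pos[OF assms], of N] slope_interp_integrable[OF h_pos[OF assms], of N]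
  by (auto simp only: q_interp_def gamma_interp_def uh_eq_slope[OF assms] lamh_eq_slope N_h[OF assms]
      Bochner_Integration.integrable_minus)

lemma qh_has_weak_derivative: "N \<ge> 1 \<Longrightarrow> has_weak_derivative {0<..<T} (qh N) (uh N)"
  using affine_interp_has_weak_derivative[OF h_pos, of N N] N_h[of N]
  by (simp add: uh_eq_slope q_interp_def)

lemma lamh_by_parts:
  assumes "N \<ge> 1" "\<And>t. (\<phi> has_real_derivative \<phi>' t) (at t)" "continuous_on UNIV \<phi>'" "\<phi> 0 = 0" "\<phi> T = 0"
  shows "density_form {0<..<T} (lamh N) \<phi> = (LINT t|lebesgue_on {0<..<T}. \<gamma>h N t * \<phi>' t)"
  using affine_interp_by_parts_lebesgue[OF h_pos[OF assms(1)] assms(2,3), of N "\<gamma>n N"] assms(1,4,5) N_h[OF assms(1)]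
  by (simp add: density_form_def lamh_eq_slope gamma_interp_def)

text \<open>
  The \<open>L\<^sup>1\<close> norm of a slope is the total variation of the interpolated sequence.
\<close>

lemma lamh_L1_bound:
  assumes "N \<ge> 1"
  shows "(LINT t|lebesgue_on {0<..<T}. \<bar>lamh N t\<bar>) \<le> 3 * (m * M)"
proof -
  let ?c = "\<lambda>n. \<bar>\<gamma>n N (Suc n) - \<gamma>n N n\<bar> / h N"
  have "\<bar>lamh N t\<bar> = ?c (cell (h N) t)" for t
    using h_pos[OF assms] by (simp add: lambda_interp_def Let_def abs_minus_commute)
  then have "(LINT t|lebesgue_on {0<..<T}. \<bar>lamh N t\<bar>) = h N * (\<Sum>n<N. ?c n)"
    using integral_step_function[OF h_pos[OF assms], of N ?c] N_h[OF assms] by simp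
  also have "\<dots> = (\<Sum>n<N. \<bar>\<gamma>n N (Suc n) - \<gamma>n N n\<bar>)"
    using h_pos[OF assms] by (simp add: sum_divide_distrib[symmetric])
  finally show ?thesis
    using \<gamma>n_total_variation[OF assms] by simp
qed

lemma \<gamma>h_bound: "N \<ge> 1 \<Longrightarrow> t \<in> {0<..<T} \<Longrightarrow> \<bar>\<gamma>h N t\<bar> \<le> m * M"
  unfolding gamma_interp_def using cell_h_less[of N t]
  by (intro affine_interp_bound h_pos \<gamma>n_bound) auto

lemma \<gamma>h_nonpos:
  assumes "N \<ge> 1" "t \<in> {0<..<T}"
  shows "\<gamma>h N t \<le> 0"
proof -
  have t: "0 \<le> t" using assms by simp
  obtain s where s: "0 \<le> s" "s \<le> 1" "\<And>a. affine_interp (h N) a t = (1 - s) * a (cell (h N) t) + s * a (Suc (cell (h N) t))"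
    using affine_interp_convex[OF h_pos[OF assms(1)] t] by blast
  show ?thesis
    unfolding gamma_interp_def s(3) using s(1,2) \<gamma>n_nonpos[OF assms(1)]
    by (intro add_nonpos_nonpos mult_nonneg_nonpos) auto
qed

lemma qh_nonneg:
  assumes "N \<ge> 1" "t \<in> {0<..<T}"
  shows "0 \<le> qh N t"
proof -
  have t: "0 \<le> t" using assms by simp
  obtain s where s: "0 \<le> s" "s \<le> 1" "\<And>a. affine_interp (h N) a t = (1 - s) * a (cell (h N) t) + s * a (Suc (cell (h N) t))"
    using affine_interp_convex[OF h_pos[OF assms(1)] t] by blast
  show ?thesis
    unfolding q_interp_def s(3) using s(1,2) qn_nonneg[OF assms(1)] by simp
qed

text \<open>
  At both ends of a cell either \<open>q\<close> or \<open>\<gamma>\<close> vanishes. If \<open>\<gamma>\<close> is not zero on the cell, then \<open>q\<close> vanishes at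
  one end, and it moves by at most \<open>2 M h\<close> within the cell.
\<close>

lemma complementarity_defect:
  assumes "N \<ge> 1" "t \<in> {0<..<T}"
  shows "\<bar>qh N t * \<gamma>h N t\<bar> \<le> h N * (2 * M) * (m * M)"
proof -
  let ?n = "cell (h N) t"
  have t: "0 \<le> t" using assms by simp
  have n: "?n < N" using assms by (rule cell_h_less)
  have "qn N (Suc ?n) - qn N ?n = h N * un N (Suc ?n)"
    using algo_Suc(1)[OF m_pos h_pos[OF assms(1)], of q0 f u0 ?n] q0_pos by simp
  then have jump: "\<bar>qn N (Suc ?n) - qn N ?n\<bar> \<le> h N * (2 * M)"
    using un_bound[OF assms(1), of "Suc ?n"] n h_pos[OF assms(1)] T_pos by (simp add: abs_mult mult_left_mono)
  have compl: "qn N j * \<gamma>n N j = 0" for j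
    using contact_state_n[OF assms(1), of j] by (simp add: contact_state_def)
  have nn: "0 \<le> h N * (2 * M)"
    using h_pos[OF assms(1)] M_nonneg by (intro mult_nonneg_nonneg) auto
  consider "\<gamma>h N t = 0" | "qn N ?n = 0 \<or> qn N (Suc ?n) = 0"
    using compl[of ?n] compl[of "Suc ?n"] by (auto simp: gamma_interp_def affine_interp_def Let_def)
  then show ?thesis
  proof cases
    case 1
    then show ?thesis
      using nn m_pos M_nonneg by simp
  next
    case 2
    then have "\<bar>qn N ?n\<bar> \<le> h N * (2 * M)" "\<bar>qn N (Suc ?n)\<bar> \<le> h N * (2 * M)"
      using jump nn by auto
    then have "\<bar>qh N t\<bar> \<le> h N * (2 * M)"
      unfolding q_interp_def by (rule affine_interp_bound[OF h_pos[OF assms(1)] t])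
    then show ?thesis
      unfolding abs_mult using \<gamma>h_bound[OF assms] nn by (intro mult_mono) auto
  qed
qed

text \<open>
  By \<open>conservation\<close> the velocity is \<open>g - \<gamma> / m\<close> at the next node. Replacing the value of \<open>\<gamma>\<close> at that node by
  its interpolant costs at most one increment, which is \<open>h |\<lambda>\<^sub>h|\<close>.
\<close>

lemma uh_close:
  assumes "N \<ge> 1" "t \<in> {0<..<T}"
  shows "\<bar>uh N t - (g (real (Suc (cell (h N) t)) * h N) - \<gamma>h N t / m)\<bar> \<le> h N / m * \<bar>lamh N t\<bar>"
proof -
  let ?n = "cell (h N) t"
  have t: "0 \<le> t" using assms by simp
  have n: "?n < N" using assms by (rule cell_h_less)
  obtain s where s: "0 \<le> s" "s \<le> 1" "\<And>a. affine_interp (h N) a t = (1 - s) * a ?n + s * a (Suc ?n)"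
    using affine_interp_convex[OF h_pos[OF assms(1)] t] by blast
  have "un N (Suc ?n) = g (real (Suc ?n) * h N) - \<gamma>n N (Suc ?n) / m"
    using conservation[OF assms(1), of "Suc ?n"] n m_pos by (simp add: field_simps)
  then have "uh N t - (g (real (Suc ?n) * h N) - \<gamma>h N t / m) = (\<gamma>h N t - \<gamma>n N (Suc ?n)) / m"
    by (simp add: u_interp_def diff_divide_distrib)
  also have "\<gamma>h N t - \<gamma>n N (Suc ?n) = - ((1 - s) * (\<gamma>n N (Suc ?n) - \<gamma>n N ?n))"
    unfolding gamma_interp_def s(3) by (simp add: algebra_simps)
  also have "\<bar>- ((1 - s) * (\<gamma>n N (Suc ?n) - \<gamma>n N ?n)) / m\<bar> = (1 - s) * \<bar>\<gamma>n N (Suc ?n) - \<gamma>n N ?n\<bar> / m"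
    using s(2) m_pos by (simp add: abs_mult abs_divide)
  also have "\<dots> \<le> 1 * \<bar>\<gamma>n N (Suc ?n) - \<gamma>n N ?n\<bar> / m"
    using s(1) m_pos by (intro divide_right_mono mult_right_mono) auto
  also have "\<dots> = h N / m * \<bar>lamh N t\<bar>"
    using h_pos[OF assms(1)] assms(1) T_pos by (simp add: lambda_interp_def Let_def abs_divide abs_minus_commute)
  finally show ?thesis .
qed

section \<open>Selection of a subsequence\<close>

text \<open>
  The compensated sequence is kept constant after the last node: later states of the algorithm need not
  satisfy the one-sided estimate.
\<close>

definition compensated :: "nat \<Rightarrow> nat \<Rightarrow> real" where
  "compensated N n = m * V (real (min n N) * h N) - \<gamma>n N (min n N)"

lemma compensated_incseq:
  assumes "N \<ge> 1"
  shows "incseq (compensated N)"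
proof (rule incseq_SucI)
  show "compensated N n \<le> compensated N (Suc n)" for n
    using \<gamma>n_increment[OF assms, of n]
    by (cases "n < N") (auto simp: compensated_def min_def not_less right_diff_distrib le_Suc_eq)
qed

lemma compensated_bound:
  assumes "N \<ge> 1"
  shows "\<bar>compensated N n\<bar> \<le> 2 * (m * M)"
proof -
  have "0 \<le> V (real (min n N) * h N)" "V (real (min n N) * h N) \<le> M"
    using V_bounds[OF node_nonneg node_le[OF assms], of "min n N"] by auto
  then have "0 \<le> m * V (real (min n N) * h N)" "m * V (real (min n N) * h N) \<le> m * M"
    using m_pos by auto
  moreover have "\<bar>\<gamma>n N (min n N)\<bar> \<le> m * M"
    by (rule \<gamma>n_bound[OF assms]) simp
  ultimately show ?thesis
    unfolding compensated_def by linarith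
qed

lemma affine_interp_compensated:
  assumes "N \<ge> 1" "t \<in> {0<..<T}"
  shows "affine_interp (h N) (compensated N) t
    = m * affine_interp (h N) (\<lambda>n. V (real n * h N)) t - \<gamma>h N t"
proof -
  have "affine_interp (h N) (compensated N) t = affine_interp (h N) (\<lambda>n. m * V (real n * h N) - 1 * \<gamma>n N n) t"
    using cell_h_less[OF assms] by (simp add: affine_interp_def compensated_def Let_def min_def)
  then show ?thesis
    unfolding affine_interp_diff by (simp add: gamma_interp_def)
qed

lemma h_tendsto_0:
  assumes "strict_mono r"
  shows "(\<lambda>k. h (r k)) \<longlonglongrightarrow> 0"
  unfolding h_def
  by (intro real_tendsto_divide_at_top[OF tendsto_const]
      filterlim_compose[OF filterlim_real_sequentially filterlim_subseq[OF assms]])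

text \<open>
  Helly's theorem applies to the interpolants of the compensated sequences, which are monotone and
  uniformly bounded. The compensating term converges to \<open>m V\<close> everywhere because \<open>V\<close> is continuous, so
  the limit of \<open>\<gamma>\<^sub>h\<close> is recovered by subtraction.
\<close>

lemma Helly_subsequence:
  obtains r F where "strict_mono r" "\<And>k. r k \<ge> 1"
    "\<And>t. continuous (at_right t) F" "mono F" "\<And>t. \<bar>F t\<bar> \<le> 2 * (m * M)"
    "\<And>t. t \<in> {0<..<T} \<Longrightarrow> isCont F t \<Longrightarrow> (\<lambda>k. \<gamma>h (r k) t) \<longlonglongrightarrow> m * V t - F t"
proof -
  (* The times outside the interval are clipped because the selection theorem requires functions
     that are monotone on the whole line. *)
  define clip where "clip t = max 0 (min T t)" for t
  define H where "H N t = affine_interp (h N) (compensated N) (clip t)" for N t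
  have clip: "0 \<le> clip t" "clip t \<le> T" for t
    using T_pos by (auto simp: clip_def)
  have "\<exists>s. strict_mono (s :: nat \<Rightarrow> nat) \<and> (\<exists>F. (\<forall>t. continuous (at_right t) F) \<and> mono F \<and>
      (\<forall>t. \<bar>F t\<bar> \<le> 2 * (m * M)) \<and> (\<forall>t. isCont F t \<longrightarrow> (\<lambda>k. H (Suc (s k)) t) \<longlonglongrightarrow> F t))"
  proof (rule Helly_selection)
    show "continuous (at_right t) (H (Suc k))" for k t
    proof -
      have "continuous_on {0..T} (affine_interp (h (Suc k)) (compensated (Suc k)))"
        using continuous_on_affine_interp[OF h_pos[of "Suc k"], of "Suc k"] N_h[of "Suc k"] by simp
      then have "continuous_on UNIV (\<lambda>t. affine_interp (h (Suc k)) (compensated (Suc k)) (clip t))"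
        by (rule continuous_on_compose2)
          (use clip in \<open>auto simp: clip_def[abs_def] intro!: continuous_intros\<close>)
      then have "isCont (H (Suc k)) t"
        by (simp add: H_def[abs_def] continuous_on_eq_continuous_at)
      then show ?thesis
        by (rule continuous_at_imp_continuous_at_within)
    qed
    show "mono (H (Suc k))" for k
    proof (rule monoI)
      show "H (Suc k) s \<le> H (Suc k) t" if "s \<le> t" for s t
        unfolding H_def using that clip(1)[of s]
        by (intro affine_interp_mono h_pos compensated_incseq) (auto simp: clip_def)
    qed
    show "\<bar>H (Suc k) t\<bar> \<le> 2 * (m * M)" for k t
      unfolding H_def using clip by (intro affine_interp_bound h_pos compensated_bound) auto
  qed
  then obtain s F where s: "strict_mono (s :: nat \<Rightarrow> nat)"
    and F: "\<And>t. continuous (at_right t) F" "mono F" "\<And>t. \<bar>F t\<bar> \<le> 2 * (m * M)"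
      "\<And>t. isCont F t \<Longrightarrow> (\<lambda>k. H (Suc (s k)) t) \<longlonglongrightarrow> F t"
    by blast
  (* The selection theorem counts from 0, but the number of steps must be positive. *)
  define r where "r k = Suc (s k)" for k
  have r: "strict_mono r" "\<And>k. r k \<ge> 1"
    using s by (auto simp: r_def strict_mono_def)
  show ?thesis
  proof (rule that[OF r F(1-3)])
    fix t assume t: "t \<in> {0<..<T}" "isCont F t"
    have "(\<lambda>k. affine_interp (h (r k)) (\<lambda>n. V (real n * h (r k))) t) \<longlonglongrightarrow> V t"
    proof (rule tendsto_affine_interp[OF h_pos[OF r(2)] h_tendsto_0[OF r(1)] _ _ continuous_V])
      show "real (cell (h (r k)) t) * h (r k) \<in> {0..T}" "real (Suc (cell (h (r k)) t)) * h (r k) \<in> {0..T}" for k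
        using node_nonneg[of "cell (h (r k)) t" "r k"] node_nonneg[of "Suc (cell (h (r k)) t)" "r k"]
          node_le[OF r(2), of "cell (h (r k)) t" k] node_le[OF r(2), of "Suc (cell (h (r k)) t)" k] cell_h_less[OF r(2) t(1), of k]
        by auto
    qed (use t in auto)
    from tendsto_diff[OF tendsto_mult_left[OF this, of m] F(4)[OF t(2)]]
    have "(\<lambda>k. m * affine_interp (h (r k)) (\<lambda>n. V (real n * h (r k))) t - H (r k) t) \<longlonglongrightarrow> m * V t - F t"
      by (simp add: r_def)
    moreover have "H (r k) t = m * affine_interp (h (r k)) (\<lambda>n. V (real n * h (r k))) t - \<gamma>h (r k) t" for k
      using affine_interp_compensated[OF r(2) t(1), of k] t(1) by (simp add: H_def clip_def)
    ultimately show "(\<lambda>k. \<gamma>h (r k) t) \<longlonglongrightarrow> m * V t - F t"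
      by simp
  qed
qed

end

section \<open>Passage to the limit\<close>

text \<open>
  A subsequence as provided by \<open>Helly_subsequence\<close>; \<open>F\<close> is the limit of the compensated interpolants.
\<close>

locale particle_plane_subsequence = particle_plane +
  fixes r :: "nat \<Rightarrow> nat" and F :: "real \<Rightarrow> real"
  assumes r_mono: "strict_mono r" and r_ge_1: "\<And>k. r k \<ge> 1"
    and F_right_cont: "\<And>t. continuous (at_right t) F" and F_mono: "mono F"
    and F_bound: "\<And>t. \<bar>F t\<bar> \<le> 2 * (m * M)"
    and \<gamma>h_lim: "\<And>t. t \<in> {0<..<T} \<Longrightarrow> isCont F t \<Longrightarrow> (\<lambda>k. \<gamma>h (r k) t) \<longlonglongrightarrow> m * V t - F t"
begin

definition \<gamma> :: "real \<Rightarrow> real" where "\<gamma> t = m * V t - F t"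
definition u :: "real \<Rightarrow> real" where "u t = g t - \<gamma> t / m"
definition q :: "real \<Rightarrow> real" where "q t = q0 + integral {0..t} u"

lemmas h_lim = h_tendsto_0[OF r_mono]

text \<open>
  A monotone function has only countably many discontinuities.
\<close>

lemma AE_isCont_F: "AE t in lebesgue_on {0<..<T}. isCont F t"
proof -
  have "countable {t. \<not> isCont F t}"
    using F_mono by (rule mono_ctble_discont)
  then have "AE t in lebesgue. isCont F t"
    by (intro AE_I'[of "{t. \<not> isCont F t}"]) (auto intro: countable_imp_null_set_lborel null_sets_completionI)
  then show ?thesis
    by (auto simp: AE_restrict_space_iff elim: eventually_mono)
qed

lemma AE_\<gamma>h_lim: "AE t in lebesgue_on {0<..<T}. (\<lambda>k. \<gamma>h (r k) t) \<longlonglongrightarrow> \<gamma> t"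
  using AE_isCont_F AE_space by eventually_elim (use \<gamma>h_lim in \<open>auto simp: \<gamma>_def\<close>)

lemma \<gamma>_integrable: "integrable (lebesgue_on {0<..<T}) \<gamma>"
proof -
  interpret finite_measure "lebesgue_on {0<..<T}"
    by (intro finite_measure_lebesgue_on) auto
  have "F \<in> borel_measurable (lebesgue_on {0<..<T})"
    using borel_measurable_mono[OF F_mono]
    by (intro measurable_restrict_space1 measurable_completion) simp
  then have "integrable (lebesgue_on {0<..<T}) F"
    using F_bound by (intro integrable_const_bound[of _ "2 * (m * M)"]) auto
  then show ?thesis
    unfolding \<gamma>_def[abs_def] using continuous_imp_integrable_Ioo[OF continuous_V] by simp
qed

lemma u_integrable: "integrable (lebesgue_on {0<..<T}) u"
  unfolding u_def[abs_def] using continuous_imp_integrable_Ioo[OF continuous_g] \<gamma>_integrable by simp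

lemma \<gamma>h_L1_conv: "L1_conv {0<..<T} (\<lambda>k. \<gamma>h (r k)) \<gamma>"
  using \<gamma>_integrable interp_integrable(3) r_ge_1 \<gamma>h_bound AE_\<gamma>h_lim
  by (intro L1_conv_dominatedI[of _ _ _ "m * M"]) auto

text \<open>
  The error splits into three terms: the free velocity is taken at the next node, \<open>\<gamma>\<^sub>h\<close> stands for \<open>\<gamma>\<close>,
  and \<open>\<gamma>\<close> is interpolated rather than evaluated at the next node. The last one is \<open>h / m\<close> times
  the \<open>L\<^sup>1\<close> norm of \<open>\<lambda>\<^sub>h\<close>, which is bounded.
\<close>

lemma uh_L1_conv: "L1_conv {0<..<T} (\<lambda>k. uh (r k)) u"
proof -
  let ?I = "lebesgue_on {0<..<T}"
  define G where "G k t = g (real (Suc (cell (h (r k)) t)) * h (r k))" for k t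
  have node: "0 \<le> real (Suc (cell (h (r k)) t)) * h (r k)" "real (Suc (cell (h (r k)) t)) * h (r k) \<le> T"
    if "t \<in> {0<..<T}" for k t
    using cell_h_less[OF r_ge_1 that, of k] by (auto intro!: node_nonneg node_le[OF r_ge_1] simp del: of_nat_Suc)
  have G_int: "integrable ?I (G k)" for k
    using step_function_integrable[OF h_pos[OF r_ge_1[of k]], of "r k" "\<lambda>n. g (real (Suc n) * h (r k))"]
    by (simp add: G_def[abs_def] N_h[OF r_ge_1] del: of_nat_Suc)
  have g_int: "integrable ?I g"
    by (rule continuous_imp_integrable_Ioo[OF continuous_g])
  have "L1_conv {0<..<T} G g"
  proof (rule L1_conv_dominatedI[OF _ G_int g_int])
    show "\<bar>G k t\<bar> \<le> M" if "t \<in> {0<..<T}" for k t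
      unfolding G_def using node[OF that] by (rule g_bound)
    show "AE t in ?I. (\<lambda>k. G k t) \<longlonglongrightarrow> g t"
    proof (rule AE_I2)
      fix t assume "t \<in> space ?I"
      then show "(\<lambda>k. G k t) \<longlonglongrightarrow> g t"
        unfolding G_def using tendsto_node(2)[OF h_pos[OF r_ge_1] h_lim, of t] node
        by (auto intro!: continuous_on_tendsto_compose[OF continuous_g] always_eventually simp del: of_nat_Suc)
    qed
  qed auto
  show ?thesis
  proof (rule L1_conv_boundI[OF interp_integrable(2)[OF r_ge_1] u_integrable])
    let ?e = "\<lambda>k. (LINT t|?I. \<bar>G k t - g t\<bar>) + (LINT t|?I. \<bar>\<gamma>h (r k) t - \<gamma> t\<bar>) / m
      + h (r k) / m * (3 * (m * M))"
    show "(LINT t|?I. \<bar>uh (r k) t - u t\<bar>) \<le> ?e k" for k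
    proof -
      note int = G_int[of k] g_int \<gamma>_integrable u_integrable interp_integrable[OF r_ge_1, of k]
      have "(LINT t|?I. \<bar>uh (r k) t - u t\<bar>) \<le>
        (LINT t|?I. \<bar>G k t - g t\<bar> + \<bar>\<gamma>h (r k) t - \<gamma> t\<bar> / m + h (r k) / m * \<bar>lamh (r k) t\<bar>)"
      proof (rule integral_mono)
        fix t assume "t \<in> space ?I"
        then have t: "t \<in> {0<..<T}" by simp
        have "uh (r k) t - u t = (uh (r k) t - (G k t - \<gamma>h (r k) t / m)) + (G k t - g t) - (\<gamma>h (r k) t - \<gamma> t) / m"
          by (simp add: u_def diff_divide_distrib)
        moreover have "\<bar>(\<gamma>h (r k) t - \<gamma> t) / m\<bar> = \<bar>\<gamma>h (r k) t - \<gamma> t\<bar> / m"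
          using m_pos by (simp add: abs_divide)
        ultimately show "\<bar>uh (r k) t - u t\<bar> \<le> \<bar>G k t - g t\<bar> + \<bar>\<gamma>h (r k) t - \<gamma> t\<bar> / m + h (r k) / m * \<bar>lamh (r k) t\<bar>"
          using uh_close[OF r_ge_1 t, of k] unfolding G_def by linarith
      qed (use int in auto)
      also have "\<dots> = (LINT t|?I. \<bar>G k t - g t\<bar>) + (LINT t|?I. \<bar>\<gamma>h (r k) t - \<gamma> t\<bar>) / m
          + h (r k) / m * (LINT t|?I. \<bar>lamh (r k) t\<bar>)"
        using int by simp
      also have "\<dots> \<le> ?e k"
        using lamh_L1_bound[OF r_ge_1, of k] h_pos[OF r_ge_1, of k] m_pos
        by (intro add_left_mono mult_left_mono) auto
      finally show ?thesis .
    qed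
    have "(\<lambda>k. (LINT t|?I. \<bar>G k t - g t\<bar>)) \<longlonglongrightarrow> 0" "(\<lambda>k. (LINT t|?I. \<bar>\<gamma>h (r k) t - \<gamma> t\<bar>)) \<longlonglongrightarrow> 0"
      using \<open>L1_conv {0<..<T} G g\<close> \<gamma>h_L1_conv by (auto simp: L1_conv_def)
    then have "?e \<longlonglongrightarrow> 0 + 0 / m + 0 / m * (3 * (m * M))"
      using m_pos by (intro tendsto_intros h_lim) auto
    then show "?e \<longlonglongrightarrow> 0"
      by simp
  qed
qed

lemma u_integrable_on: "u integrable_on {0..T}"
  using integrable_on_lebesgue_on[OF u_integrable] by (simp add: integrable_on_Icc_iff_Ioo)

lemma continuous_q: "continuous_on {0..T} q"
  unfolding q_def by (intro continuous_intros indefinite_integral_continuous_1 u_integrable_on)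

text \<open>
  Both \<open>q\<^sub>h\<close> and \<open>q\<close> start from \<open>q\<^sup>0\<close> and are primitives of \<open>u\<^sub>h\<close> and \<open>u\<close>.
\<close>

lemma qh_close:
  assumes "t \<in> {0<..<T}"
  shows "\<bar>qh (r k) t - q t\<bar> \<le> (LINT t|lebesgue_on {0<..<T}. \<bar>uh (r k) t - u t\<bar>)"
proof -
  let ?d = "\<lambda>t. uh (r k) t - u t"
  have "(uh (r k) has_integral affine_interp (h (r k)) (qn (r k)) t - qn (r k) 0) {0..t}"
    unfolding uh_eq_slope[OF r_ge_1]
    by (rule has_integral_slope_interp[OF h_pos[OF r_ge_1], of _ "r k"]) (use assms N_h[OF r_ge_1] in auto)
  then have qh: "(uh (r k) has_integral qh (r k) t - q0) {0..t}"
    by (simp add: q_interp_def algo_q_def)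
  have "u integrable_on {0..t}"
    using u_integrable_on by (rule integrable_subinterval_real) (use assms in auto)
  then have "(u has_integral q t - q0) {0..t}"
    by (simp add: q_def integrable_integral)
  from has_integral_diff[OF qh this] have d: "(?d has_integral qh (r k) t - q t) {0..t}"
    by simp
  have int: "integrable (lebesgue_on {0<..<T}) (\<lambda>t. \<bar>?d t\<bar>)"
    using interp_integrable(2)[OF r_ge_1, of k] u_integrable by simp
  then have abs: "(\<lambda>t. \<bar>?d t\<bar>) integrable_on {0..T}"
    using integrable_on_lebesgue_on[OF int] by (simp add: integrable_on_Icc_iff_Ioo)
  have abs_t: "(\<lambda>t. \<bar>?d t\<bar>) integrable_on {0..t}"
    using abs by (rule integrable_subinterval_real) (use assms in auto)
  have "\<bar>qh (r k) t - q t\<bar> = \<bar>integral {0..t} ?d\<bar>"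
    using d by (simp add: integral_unique)
  also have "\<dots> \<le> integral {0..t} (\<lambda>t. \<bar>?d t\<bar>)"
    using integral_norm_bound_integral[of ?d "{0..t}" "\<lambda>t. \<bar>?d t\<bar>"] d abs_t by (auto simp: has_integral_integrable)
  also have "\<dots> \<le> integral {0..T} (\<lambda>t. \<bar>?d t\<bar>)"
    using abs_t abs assms by (intro integral_subset_le) auto
  also have "\<dots> = (LINT t|lebesgue_on {0<..<T}. \<bar>?d t\<bar>)"
    using lebesgue_integral_eq_integral[OF int] by (simp add: integral_open_interval_real)
  finally show ?thesis .
qed

lemma uh_error_lim: "(\<lambda>k. LINT t|lebesgue_on {0<..<T}. \<bar>uh (r k) t - u t\<bar>) \<longlonglongrightarrow> 0"
  using uh_L1_conv by (simp add: L1_conv_def)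

lemma qh_lim:
  assumes "t \<in> {0<..<T}"
  shows "(\<lambda>k. qh (r k) t) \<longlonglongrightarrow> q t"
  by (rule LIM_zero_cancel, rule tendsto_rabs_zero_cancel, rule tendsto_sandwich[OF _ _ tendsto_const uh_error_lim])
    (use qh_close[OF assms] in auto)

lemma q_integrable: "integrable (lebesgue_on {0<..<T}) q"
  by (rule continuous_imp_integrable_Ioo[OF continuous_q])

lemma qh_Linfty_conv: "Linfty_conv {0<..<T} (\<lambda>k. qh (r k)) q"
  using T_pos q_integrable interp_integrable(1)[OF r_ge_1] qh_close uh_error_lim
  by (intro uniform_bound_imp_Linfty_conv) auto

lemma qh_L1_conv: "L1_conv {0<..<T} (\<lambda>k. qh (r k)) q"
proof (rule L1_conv_boundI[OF interp_integrable(1)[OF r_ge_1] q_integrable])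
  let ?I = "lebesgue_on {0<..<T}"
  let ?e = "\<lambda>k. LINT t|?I. \<bar>uh (r k) t - u t\<bar>"
  show "(LINT t|?I. \<bar>qh (r k) t - q t\<bar>) \<le> T * ?e k" for k
  proof -
    interpret finite_measure ?I
      by (intro finite_measure_lebesgue_on) auto
    have "(LINT t|?I. \<bar>qh (r k) t - q t\<bar>) \<le> (LINT t|?I. ?e k)"
      using interp_integrable(1)[OF r_ge_1, of k] q_integrable qh_close[of _ k] by (intro integral_mono) auto
    also have "\<dots> = T * ?e k"
      using T_pos by (simp add: measure_restrict_space)
    finally show ?thesis .
  qed
  show "(\<lambda>k. T * ?e k) \<longlonglongrightarrow> 0"
    using uh_error_lim by (rule tendsto_mult_right_zero)
qed

lemma q_has_weak_derivative: "has_weak_derivative {0<..<T} q u"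
  using qh_has_weak_derivative[OF r_ge_1] qh_L1_conv uh_L1_conv by (rule has_weak_derivative_limit)

lemma qh_W11_conv: "W11_conv {0<..<T} (\<lambda>k. qh (r k)) q"
  unfolding W11_conv_def
  using qh_has_weak_derivative[OF r_ge_1] q_has_weak_derivative qh_L1_conv uh_L1_conv
  by (intro exI[of _ "\<lambda>k. uh (r k)"] exI[of _ u]) auto

lemma q_nonneg: "t \<in> {0<..<T} \<Longrightarrow> q t \<ge> 0"
  using qh_nonneg[OF r_ge_1] by (intro LIMSEQ_le_const[OF qh_lim]) auto

lemma AE_\<gamma>_nonpos: "AE t in lebesgue_on {0<..<T}. \<gamma> t \<le> 0"
  using AE_\<gamma>h_lim AE_space
  by eventually_elim (use \<gamma>h_nonpos[OF r_ge_1] in \<open>auto intro!: LIMSEQ_le_const2\<close>)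

lemma AE_complementarity: "AE t in lebesgue_on {0<..<T}. q t * \<gamma> t = 0"
  using AE_\<gamma>h_lim AE_space
proof eventually_elim
  case (elim t)
  then have t: "t \<in> {0<..<T}" by simp
  have "(\<lambda>k. qh (r k) t * \<gamma>h (r k) t) \<longlonglongrightarrow> q t * \<gamma> t"
    using qh_lim[OF t] elim(1) by (rule tendsto_mult)
  moreover have "(\<lambda>k. qh (r k) t * \<gamma>h (r k) t) \<longlonglongrightarrow> 0"
  proof (rule tendsto_rabs_zero_cancel, rule tendsto_sandwich[OF _ _ tendsto_const])
    show "(\<lambda>k. h (r k) * (2 * M) * (m * M)) \<longlonglongrightarrow> 0"
      by (intro tendsto_mult_left_zero h_lim)
  qed (use complementarity_defect[OF r_ge_1 t] in auto)
  ultimately show ?case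
    by (rule LIMSEQ_unique)
qed

section \<open>Bounded variation and initial values of the limit\<close>

text \<open>
  The difference \<open>m V - F\<close> of monotone functions varies at most as much as their sum.
\<close>

lemma \<gamma>_increments:
  assumes "0 \<le> s" "s \<le> t" "t \<le> T"
  shows "\<bar>\<gamma> t - \<gamma> s\<bar> \<le> (m * V t + F t) - (m * V s + F s)"
proof -
  have "m * V s \<le> m * V t"
    using V_mono[OF assms] m_pos by simp
  then show ?thesis
    using monoD[OF F_mono assms(2)] unfolding \<gamma>_def by linarith
qed

lemma variation_bound:
  assumes "t \<in> {0<..<T}"
  shows "\<bar>m * V t + F t\<bar> \<le> 3 * (m * M)"
proof -
  have "0 \<le> m * V t" "m * V t \<le> m * M"
    using V_bounds[of t] assms m_pos by auto
  then show ?thesis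
    using F_bound[of t] by linarith
qed

lemma \<gamma>_BV: "\<gamma> \<in> BV {0<..<T}"
  using \<gamma>_increments variation_bound by (intro BV_if_increments_bounded[where W = "\<lambda>t. m * V t + F t"]) auto

lemma u_BV: "u \<in> BV {0<..<T}"
proof (rule BV_if_increments_bounded[where W = "\<lambda>t. V t + (m * V t + F t) / m" and B = "4 * M"])
  fix s t assume st: "s \<in> {0<..<T}" "t \<in> {0<..<T}" "s \<le> t"
  then have "\<bar>\<gamma> t - \<gamma> s\<bar> / m \<le> ((m * V t + F t) - (m * V s + F s)) / m"
    using m_pos by (intro divide_right_mono \<gamma>_increments) auto
  moreover have "\<bar>(\<gamma> t - \<gamma> s) / m\<bar> = \<bar>\<gamma> t - \<gamma> s\<bar> / m"
    using m_pos by (simp add: abs_divide)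
  moreover have "u t - u s = (g t - g s) - (\<gamma> t - \<gamma> s) / m"
    by (simp add: u_def diff_divide_distrib)
  moreover have "\<bar>g t - g s\<bar> \<le> V t - V s"
    using st by (intro g_diff) auto
  ultimately show "\<bar>u t - u s\<bar> \<le> (V t + (m * V t + F t) / m) - (V s + (m * V s + F s) / m)"
    unfolding diff_divide_distrib by linarith
next
  fix t assume t: "t \<in> {0<..<T}"
  have "\<bar>(m * V t + F t) / m\<bar> \<le> 3 * (m * M) / m"
    unfolding abs_divide using variation_bound[OF t] m_pos by (intro frac_le) auto
  then have "\<bar>(m * V t + F t) / m\<bar> \<le> 3 * M"
    using m_pos by simp
  moreover have "\<bar>V t\<bar> \<le> M"
    using V_bounds[of t] t by auto
  moreover have "\<bar>x + y\<bar> \<le> 4 * M" if "\<bar>y\<bar> \<le> 3 * M" "\<bar>x\<bar> \<le> M" for x y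
    using that by linarith
  ultimately show "\<bar>V t + (m * V t + F t) / m\<bar> \<le> 4 * M"
    by blast
qed

lemma at_right_0_tendsto:
  fixes \<phi> :: "real \<Rightarrow> real"
  assumes "continuous_on {0..T} \<phi>"
  shows "(\<phi> \<longlongrightarrow> \<phi> 0) (at_right 0)"
  using continuous_on_Icc_at_rightD[OF assms T_pos] .

lemma q_initial: "(q \<longlongrightarrow> q0) (at_right 0)"
  using at_right_0_tendsto[OF continuous_q] by (simp add: q_def)

text \<open>
  The right limit exists because \<open>F\<close> is continuous from the right. It is zero because \<open>q\<close> is positive
  near the start and \<open>q \<gamma> = 0\<close> almost everywhere.
\<close>

lemma \<gamma>_initial: "(\<gamma> \<longlongrightarrow> 0) (at_right 0)"
proof -
  have lim: "(\<gamma> \<longlongrightarrow> - F 0) (at_right 0)"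
  proof -
    have "(F \<longlongrightarrow> F 0) (at_right 0)"
      using F_right_cont[of 0] by (simp add: continuous_within)
    from tendsto_diff[OF tendsto_mult_left[OF at_right_0_tendsto[OF continuous_V], of m] this]
    show ?thesis
      by (simp add: \<gamma>_def[abs_def] V_0)
  qed
  have "F 0 = 0"
  proof (rule ccontr)
    assume "F 0 \<noteq> 0"
    then have "\<forall>\<^sub>F t in at_right 0. \<gamma> t \<noteq> 0"
      using tendsto_imp_eventually_ne[OF lim, of 0] by simp
    moreover have "\<forall>\<^sub>F t in at_right 0. q t > 0"
      using order_tendstoD(1)[OF q_initial q0_pos] .
    ultimately have "\<forall>\<^sub>F t in at_right 0. q t * \<gamma> t \<noteq> 0"
      by eventually_elim simp
    then obtain b where b: "b > 0" "\<And>t. 0 < t \<Longrightarrow> t < b \<Longrightarrow> q t * \<gamma> t \<noteq> 0"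
      unfolding eventually_at_right_field by auto
    have "\<exists>t\<in>{0<..<min b T}. q t * \<gamma> t = 0"
      using AE_complementarity by (rule AE_lebesgue_on_ex) (use b(1) T_pos in auto)
    then show False
      using b(2) by auto
  qed
  then show ?thesis
    using lim by simp
qed

lemma u_initial: "(u \<longlongrightarrow> u0) (at_right 0)"
proof -
  have "((\<lambda>t. g t - \<gamma> t / m) \<longlongrightarrow> g 0 - 0 / m) (at_right 0)"
    using m_pos by (intro tendsto_intros at_right_0_tendsto[OF continuous_g] \<gamma>_initial) auto
  then show ?thesis
    by (simp add: u_def[abs_def] g_0)
qed

lemma limit_solves_problem: "solves_limit_problem T m f q0 u0 q \<gamma>"
  unfolding solves_limit_problem_def
proof (intro exI conjI)
  show "has_weak_derivative {0<..<T} q u"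
    by (rule q_has_weak_derivative)
  show "has_initial_value T u u0"
    unfolding has_initial_value_def using u_BV u_initial by auto
  show "AE t in lebesgue_on {0<..<T}. m * u t + \<gamma> t = m * (u0 + (LINT s|lebesgue_on {0<..<t}. f s))"
    using m_pos by (intro AE_I2) (auto simp: integral_force_eq u_def right_diff_distrib)
qed (use q_nonneg AE_\<gamma>_nonpos AE_complementarity q_initial q0_pos in auto)

text \<open>
  Against a continuously differentiable function that vanishes at the ends, \<open>\<lambda>\<^sub>h\<close> integrates by parts
  to \<open>\<gamma>\<^sub>h\<close>, which converges in \<open>L\<^sup>1\<close>.
\<close>

lemma lamh_weak_star:
  obtains \<Lambda> where "weak_star_conv {0<..<T} (\<lambda>k. density_form {0<..<T} (lamh (r k))) \<Lambda>"
proof (rule weak_star_compactness[OF T_pos interp_integrable(4)[OF r_ge_1] lamh_L1_bound[OF r_ge_1]])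
  fix p p' :: "real \<Rightarrow> real"
  assume p: "\<And>t. (p has_real_derivative p' t) (at t)" "continuous_on UNIV p'" "p 0 = 0" "p T = 0"
  have "(\<lambda>k. LINT t|lebesgue_on {0<..<T}. \<gamma>h (r k) t * p' t) \<longlonglongrightarrow> (LINT t|lebesgue_on {0<..<T}. \<gamma> t * p' t)"
    using \<gamma>h_L1_conv p(2) by (rule L1_conv_integral_mult_continuous)
  then show "convergent (\<lambda>k. density_form {0<..<T} (lamh (r k)) p)"
    unfolding lamh_by_parts[OF r_ge_1 p] by (rule convergentI)
qed

lemma \<gamma>_differential_measure:
  assumes "weak_star_conv {0<..<T} (\<lambda>k. density_form {0<..<T} (lamh (r k))) \<Lambda>"
  shows "has_differential_measure {0<..<T} \<gamma> (\<lambda>\<phi>. - \<Lambda> \<phi>)"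
  unfolding has_differential_measure_def
proof (intro conjI ballI \<gamma>_integrable)
  have \<Lambda>: "\<Lambda> \<in> measures_on {0<..<T}"
    using assms by (simp add: weak_star_conv_def)
  then show "(\<lambda>\<phi>. - \<Lambda> \<phi>) \<in> measures_on {0<..<T}"
    by (auto simp: measures_on_def)
  fix \<phi> assume \<phi>: "\<phi> \<in> Cc_smooth {0<..<T}"
  then have Cc: "\<phi> \<in> Cc {0<..<T}"
    by (simp add: Cc_smooth_def)
  have "density_form {0<..<T} (lamh (r k)) \<phi> = (LINT t|lebesgue_on {0<..<T}. \<gamma>h (r k) t * deriv \<phi> t)" for k
    using Cc_smooth_deriv[OF \<phi>] Cc_eq_0[OF Cc] by (intro lamh_by_parts r_ge_1) auto
  moreover have "(\<lambda>k. density_form {0<..<T} (lamh (r k)) \<phi>) \<longlonglongrightarrow> \<Lambda> \<phi>"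
    using assms Cc by (simp add: weak_star_conv_def)
  moreover have "(\<lambda>k. LINT t|lebesgue_on {0<..<T}. \<gamma>h (r k) t * deriv \<phi> t)
      \<longlonglongrightarrow> (LINT t|lebesgue_on {0<..<T}. \<gamma> t * deriv \<phi> t)"
    using \<gamma>h_L1_conv Cc_smooth_deriv(2)[OF \<phi>] by (rule L1_conv_integral_mult_continuous)
  ultimately show "(LINT t|lebesgue_on {0<..<T}. \<gamma> t * deriv \<phi> t) = - (- \<Lambda> \<phi>)"
    using LIMSEQ_unique by auto
qed

end

section \<open>Convergence of the scheme\<close>

theorem theorem2p8:
  fixes T m q0 u0 :: real and f :: "real \<Rightarrow> real"
  assumes "T > 0" and "m > 0" and "q0 > 0"
    and "integrable (lebesgue_on {0<..<T}) f"
  shows "\<exists>(r :: nat \<Rightarrow> nat) q \<gamma> u \<Lambda>.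
    strict_mono r \<and> (\<forall>k. r k \<ge> 1) \<and>
    q \<in> W11 {0<..<T} \<and> continuous_on {0<..<T} q \<and>
    \<gamma> \<in> BV {0<..<T} \<and>
    integrable (lebesgue_on {0<..<T}) u \<and>
    \<Lambda> \<in> measures_on {0<..<T} \<and>
    L1_conv {0<..<T} (\<lambda>k. u_interp m (T / real (r k)) f q0 u0) u \<and>
    W11_conv {0<..<T} (\<lambda>k. q_interp m (T / real (r k)) f q0 u0) q \<and>
    Linfty_conv {0<..<T} (\<lambda>k. q_interp m (T / real (r k)) f q0 u0) q \<and>
    has_weak_derivative {0<..<T} q u \<and>
    weak_star_conv {0<..<T}
      (\<lambda>k. density_form {0<..<T} (lambda_interp m (T / real (r k)) f q0 u0)) \<Lambda> \<and>
    L1_conv {0<..<T} (\<lambda>k. gamma_interp m (T / real (r k)) f q0 u0) \<gamma> \<and>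
    has_differential_measure {0<..<T} \<gamma> (\<lambda>\<phi>. - \<Lambda> \<phi>) \<and>
    solves_limit_problem T m f q0 u0 q \<gamma>"
proof -
  interpret P: particle_plane T m q0 u0 f
    using assms by unfold_locales
  obtain r F where "strict_mono r" "\<And>k. r k \<ge> 1"
    "\<And>t. continuous (at_right t) F" "mono F" "\<And>t. \<bar>F t\<bar> \<le> 2 * (m * P.M)"
    "\<And>t. t \<in> {0<..<T} \<Longrightarrow> isCont F t \<Longrightarrow>
      (\<lambda>k. gamma_interp m (P.h (r k)) f q0 u0 t) \<longlonglongrightarrow> m * P.V t - F t"
    using P.Helly_subsequence by blast
  then interpret S: particle_plane_subsequence T m q0 u0 f r F
    by unfold_locales
  obtain \<Lambda> where \<Lambda>: "weak_star_conv {0<..<T}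
      (\<lambda>k. density_form {0<..<T} (lambda_interp m (P.h (r k)) f q0 u0)) \<Lambda>"
    using S.lamh_weak_star by blast
  have "S.q \<in> W11 {0<..<T}"
    using S.q_has_weak_derivative by (auto simp: W11_def)
  moreover have "continuous_on {0<..<T} S.q"
    using S.continuous_q by (rule continuous_on_subset) auto
  moreover have "\<Lambda> \<in> measures_on {0<..<T}"
    using \<Lambda> by (simp add: weak_star_conv_def)
  ultimately show ?thesis
    using S.r_mono S.r_ge_1 S.\<gamma>_BV S.u_integrable S.uh_L1_conv S.qh_W11_conv S.qh_Linfty_conv
      S.q_has_weak_derivative \<Lambda> S.\<gamma>h_L1_conv S.\<gamma>_differential_measure[OF \<Lambda>] S.limit_solves_problem
    unfolding P.h_def
    by (intro exI[of _ r] exI[of _ S.q] exI[of _ S.\<gamma>] exI[of _ S.u] exI[of _ \<Lambda>] conjI allI)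
qed

end
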